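(* Let $\omega=\omega_{\boldsymbol{c}}\cup\omega_E$ be partitioned into a corner patch with partition $\mathscr{P}$ (see context), where (i) the partition of $\omega_{\boldsymbol{c}}$ is such that the pair $\boldsymbol{V}_{\mathscr{P}}(\omega_{\boldsymbol{c}})\times M_{\mathscr{P}}(\omega_{\boldsymbol{c}})$ is (uniformly) inf-sup stable with a constant $\beta_{\boldsymbol{c}}>0$; (ii) the "overlapped" edge patch $\omega_E$ contains at least one division orthogonal to its "long and thin" elements; more precisely, every "long and thin" element is divided into two "long and thin" elements by such a division. Let $\beta>0$ be the inf-sup constant, independent of the shape and size of the elements, that edge patches satisfying (ii) possess (see context). Then there exists $\beta_{\mathscr{P}}>0$, depending only on $\beta$ and $\beta_{\boldsymbol{c}}$, such that $$\inf_{0\neq q\in M_{\mathscr{P}}(\omega)}\ \sup_{\boldsymbol{0}\neq\boldsymbol{v}\in \boldsymbol{V}_{\mathscr{P}}(\omega)}\ \frac{\int_\omega q\,\operatorname{div}\boldsymbol{v}\,\mathrm{d}\boldsymbol{x}}{|\boldsymbol{v}|_{1,\omega}\,\|q\|_{0,\omega}}\ \ge\ \beta_{\mathscr{P}} .$$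
   Context: **Spaces.** For a set $D$ that is a union of cells of a conforming partition $\mathscr{P}$ into closed axis-parallel rectangles, $\mathbb{Q}_\ell(K)$ is the space of polynomials on $K$ of degree at most $\ell$ in each variable. $M_{\mathscr{P}}(D)$ is the space of functions $q$ continuous on $D$, belonging to $\mathbb{Q}_1(K)$ on each cell $K\subseteq D$, with $\int_D q=0$. $\boldsymbol{V}_{\mathscr{P}}(D)$ is the space of continuous vector fields $\boldsymbol{v}:D\to\mathbb{R}^2$ with $\boldsymbol{v}|_K\in\mathbb{Q}_2(K)^2$ on each cell $K\subseteq D$ and $\boldsymbol{v}=\boldsymbol{0}$ on $\partial D$. $\|\cdot\|_{0,D}$ is the $L^2(D)$ norm and $|\boldsymbol{v}|_{1,D}=\|\nabla\boldsymbol{v}\|_{0,D}$. The pair $\boldsymbol{V}_{\mathscr{P}}(D)\times M_{\mathscr{P}}(D)$ is inf-sup stable with constant $b$ if $\inf_{q}\sup_{\boldsymbol{v}}\int_D q\operatorname{div}\boldsymbol{v}\,\mathrm{d}\boldsymbol{x}/(|\boldsymbol{v}|_{1,D}\|q\|_{0,D})\ge b$ over nonzero $q\in M_{\mathscr{P}}(D)$, $\boldsymbol{v}\in\boldsymbol{V}_{\mathscr{P}}(D)$. **Corner patches.** A coarse corner patch is a shape-regular rectangle divided by one line parallel to each pair of sides into four cells: a small shape-regular cell $C$ at one vertex, two long and thin cells each sharing an edge with $C$, and a large shape-regular cell. A corner patch $\omega$ is obtained by subdividing the cells of such a coarse patch, or of a patch formed by joining several of them around the common vertex of their small cells. It is decomposed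 as $\omega=\omega_{\boldsymbol{c}}\cup\omega_E$, where $\omega_{\boldsymbol{c}}$ is the small shape-regular region (the small cell, or the union of the small cells) and $\omega_E$, the "overlapped" edge patch, is the union of all the remaining cells. Each long and thin coarse cell is divided into two long and thin elements (by one division orthogonal to its long side), or into four (if it is also bisected along its length); further uniform refinement of the patch is not considered. For a single corner patch, condition (i) requires $C$ to be refined. If several patches are joined, the presence of enough degrees of freedom inside $\omega_{\boldsymbol{c}}$ ensures (i) without further refinement of the small cells. **The constant $\beta$.** Edge patches satisfying (ii) are uniformly inf-sup stable: there is $\beta>0$, independent of the shape and size of the elements, such that $\boldsymbol{V}_{\mathscr{P}}(\omega_E)\times M_{\mathscr{P}}(\omega_E)$ is inf-sup stable with constant $\beta$. *)

theory Defs
  imports "HOL-Analysis.Analysis"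
begin

subsection \<open>Conforming partitions into rectangles\<close>

text \<open>With closed cells, \<^const>\<open>face_of\<close> makes two cells meet in the empty set, in a common
  vertex or in a common full edge.\<close>

definition conforming_partition :: "(real \<times> real) set set \<Rightarrow> (real \<times> real) set \<Rightarrow> bool" where
  "conforming_partition P D \<longleftrightarrow>
     P division_of D \<and> (\<forall>K\<in>P. interior K \<noteq> {}) \<and> (\<forall>K\<in>P. \<forall>L\<in>P. (K \<inter> L) face_of K)"

definition Q_space :: "nat \<Rightarrow> (real \<times> real) set \<Rightarrow> (real \<times> real \<Rightarrow> real) set" where
  "Q_space l K =
     {q. \<exists>c :: nat \<Rightarrow> nat \<Rightarrow> real. \<forall>x\<in>K. q x = (\<Sum>i\<le>l. \<Sum>j\<le>l. c i j * fst x ^ i * snd x ^ j)}"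


subsection \<open>Pressure and velocity spaces\<close>

text \<open>Functions on \<open>D\<close> are represented by functions on the whole plane whose values outside \<open>D\<close>
  are irrelevant; accordingly, ``nonzero'' always means ``not identically zero on \<open>D\<close>''.\<close>

definition M_space :: "(real \<times> real) set set \<Rightarrow> (real \<times> real) set \<Rightarrow> (real \<times> real \<Rightarrow> real) set" where
  "M_space P D =
     {q. continuous_on D q \<and> (\<forall>K\<in>P. K \<subseteq> D \<longrightarrow> q \<in> Q_space 1 K) \<and> integral D q = 0}"

definition V_space ::
    "(real \<times> real) set set \<Rightarrow> (real \<times> real) set \<Rightarrow> (real \<times> real \<Rightarrow> real \<times> real) set" where
  "V_space P D =
     {v. continuous_on D v \<and>
         (\<forall>K\<in>P. K \<subseteq> D \<longrightarrow> (\<lambda>x. fst (v x)) \<in> Q_space 2 K \<and> (\<lambda>x. snd (v x)) \<in> Q_space 2 K) \<and>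
         (\<forall>x\<in>frontier D. v x = 0)}"

text \<open>The fields in \<^const>\<open>V_space\<close> may fail to be differentiable on the cell boundaries, a null set
  on which the value of \<^const>\<open>frechet_derivative\<close> is irrelevant for the integrals below.\<close>

definition divergence :: "(real \<times> real \<Rightarrow> real \<times> real) \<Rightarrow> real \<times> real \<Rightarrow> real" where
  "divergence v x = (\<Sum>e\<in>Basis. frechet_derivative v (at x) e \<bullet> e)"

definition L2_norm_on :: "(real \<times> real) set \<Rightarrow> (real \<times> real \<Rightarrow> real) \<Rightarrow> real" where
  "L2_norm_on D q = sqrt (integral D (\<lambda>x. (q x)\<^sup>2))"

definition H1_seminorm_on :: "(real \<times> real) set \<Rightarrow> (real \<times> real \<Rightarrow> real \<times> real) \<Rightarrow> real" where
  "H1_seminorm_on D v =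
     sqrt (integral D (\<lambda>x. \<Sum>e\<in>Basis. (norm (frechet_derivative v (at x) e))\<^sup>2))"

definition inf_sup :: "(real \<times> real) set set \<Rightarrow> (real \<times> real) set \<Rightarrow> ereal" where
  "inf_sup P D =
     (INF q \<in> {q \<in> M_space P D. \<exists>x\<in>D. q x \<noteq> 0}.
        SUP v \<in> {v \<in> V_space P D. \<exists>x\<in>D. v x \<noteq> 0}.
          ereal (integral D (\<lambda>x. q x * divergence v x) / (H1_seminorm_on D v * L2_norm_on D q)))"

definition inf_sup_stable :: "(real \<times> real) set set \<Rightarrow> (real \<times> real) set \<Rightarrow> real \<Rightarrow> bool" where
  "inf_sup_stable P D b \<longleftrightarrow> ereal b \<le> inf_sup P D"


subsection \<open>Shape regular and thin rectangles\<close>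

definition extent :: "real \<times> real \<Rightarrow> (real \<times> real) set \<Rightarrow> real" where
  "extent e K = (interval_upperbound K - interval_lowerbound K) \<bullet> e"

definition shape_regular :: "real \<Rightarrow> (real \<times> real) set \<Rightarrow> bool" where
  "shape_regular \<sigma> K \<longleftrightarrow> (\<forall>e\<in>Basis. \<forall>f\<in>Basis. extent e K \<le> \<sigma> * extent f K)"

text \<open>\<open>K\<close> is long in the direction \<open>e\<close>, with aspect ratio larger than \<open>\<tau>\<close>.\<close>

definition long_thin :: "real \<Rightarrow> real \<times> real \<Rightarrow> (real \<times> real) set \<Rightarrow> bool" where
  "long_thin \<tau> e K \<longleftrightarrow> (\<forall>f\<in>Basis - {e}. \<tau> * extent f K < extent e K)"


subsection \<open>Corner patches\<close>

definition rect :: "real \<times> real \<Rightarrow> real \<times> real \<Rightarrow> (real \<times> real) set" where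
  "rect p q = cbox (min (fst p) (fst q), min (snd p) (snd q))
                   (max (fst p) (fst q), max (snd p) (snd q))"

text \<open>A coarse patch is given by three points: the vertex \<open>z\<close> of the rectangle at which the small
  cell is located, the intersection \<open>m\<close> of the two division lines, and the vertex \<open>w\<close> of the
  rectangle opposite to \<open>z\<close>. The vertex \<open>z\<close> can be any of the four vertices of the rectangle.\<close>

definition small_cell :: "real \<times> real \<Rightarrow> real \<times> real \<Rightarrow> (real \<times> real) set" where
  "small_cell z m = rect z m"

definition thin_cell_x ::
    "real \<times> real \<Rightarrow> real \<times> real \<Rightarrow> real \<times> real \<Rightarrow> (real \<times> real) set" where
  "thin_cell_x z m w = rect (fst m, snd z) (fst w, snd m)"

definition thin_cell_y ::
    "real \<times> real \<Rightarrow> real \<times> real \<Rightarrow> real \<times> real \<Rightarrow> (real \<times> real) set" where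
  "thin_cell_y z m w = rect (fst z, snd m) (fst m, snd w)"

definition large_cell :: "real \<times> real \<Rightarrow> real \<times> real \<Rightarrow> (real \<times> real) set" where
  "large_cell m w = rect m w"

definition coarse_corner_patch ::
    "real \<Rightarrow> real \<Rightarrow> real \<times> real \<Rightarrow> real \<times> real \<Rightarrow> real \<times> real \<Rightarrow> bool" where
  "coarse_corner_patch \<sigma> \<tau> z m w \<longleftrightarrow>
     fst m \<in> open_segment (fst z) (fst w) \<and> snd m \<in> open_segment (snd z) (snd w) \<and>
     shape_regular \<sigma> (rect z w) \<and>
     shape_regular \<sigma> (small_cell z m) \<and> shape_regular \<sigma> (large_cell m w) \<and>
     long_thin \<tau> (1, 0) (thin_cell_x z m w) \<and> long_thin \<tau> (0, 1) (thin_cell_y z m w)"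

text \<open>A set \<open>G\<close> of pairs \<open>(m, w)\<close> describes the coarse patches joined around the common vertex \<open>z\<close>;
  a singleton gives a single patch.\<close>

definition coarse_cells ::
    "real \<times> real \<Rightarrow> ((real \<times> real) \<times> (real \<times> real)) set \<Rightarrow> (real \<times> real) set set" where
  "coarse_cells z G =
     (\<Union>(m, w)\<in>G. {small_cell z m, thin_cell_x z m w, thin_cell_y z m w, large_cell m w})"

definition omega_c ::
    "real \<times> real \<Rightarrow> ((real \<times> real) \<times> (real \<times> real)) set \<Rightarrow> (real \<times> real) set" where
  "omega_c z G = (\<Union>(m, w)\<in>G. small_cell z m)"

definition omega_E ::
    "real \<times> real \<Rightarrow> ((real \<times> real) \<times> (real \<times> real)) set \<Rightarrow> (real \<times> real) set" where
  "omega_E z G = (\<Union>(m, w)\<in>G. thin_cell_x z m w \<union> thin_cell_y z m w \<union> large_cell m w)"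

text \<open>Disjointness of the interiors of the coarse cells leaves at most one coarse patch per quadrant
  around \<open>z\<close>. Connectedness of the interior excludes two patches that only meet at \<open>z\<close>.\<close>

definition corner_patch ::
    "real \<Rightarrow> real \<Rightarrow> real \<times> real \<Rightarrow> ((real \<times> real) \<times> (real \<times> real)) set \<Rightarrow>
     (real \<times> real) set set \<Rightarrow> (real \<times> real) set \<Rightarrow> bool" where
  "corner_patch \<sigma> \<tau> z G P \<omega> \<longleftrightarrow>
     G \<noteq> {} \<and> (\<forall>(m, w)\<in>G. coarse_corner_patch \<sigma> \<tau> z m w) \<and>
     \<omega> = omega_c z G \<union> omega_E z G \<and>
     conforming_partition (coarse_cells z G) \<omega> \<and> connected (interior \<omega>) \<and>
     conforming_partition P \<omega> \<and> (\<forall>K\<in>P. \<exists>L\<in>coarse_cells z G. K \<subseteq> L)"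

definition split_at :: "real \<times> real \<Rightarrow> real \<Rightarrow> (real \<times> real) set \<Rightarrow> (real \<times> real) set set" where
  "split_at e t K = {K \<inter> {x. x \<bullet> e \<le> t}, K \<inter> {x. t \<le> x \<bullet> e}}"

definition mid :: "real \<times> real \<Rightarrow> (real \<times> real) set \<Rightarrow> real" where
  "mid f K = (interval_lowerbound K \<bullet> f + interval_upperbound K \<bullet> f) / 2"

text \<open>The coarse cell \<open>T\<close>, long in direction \<open>e\<close> and thin in direction \<open>f\<close>, is divided by \<open>P\<close> into
  two thin elements by one line orthogonal to \<open>e\<close>, or into four if it is also bisected along its
  length.\<close>

definition thin_cell_divided ::
    "real \<Rightarrow> (real \<times> real) set set \<Rightarrow> real \<times> real \<Rightarrow> real \<times> real \<Rightarrow> (real \<times> real) set \<Rightarrow> bool" where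
  "thin_cell_divided \<tau> P e f T \<longleftrightarrow>
     (\<exists>t. interval_lowerbound T \<bullet> e < t \<and> t < interval_upperbound T \<bullet> e \<and>
        ({K\<in>P. K \<subseteq> T} = split_at e t T \<or>
         {K\<in>P. K \<subseteq> T} = (\<Union>L\<in>split_at e t T. split_at f (mid f T) L))) \<and>
     (\<forall>K\<in>P. K \<subseteq> T \<longrightarrow> long_thin \<tau> e K)"

definition thin_cells_divided ::
    "real \<Rightarrow> real \<times> real \<Rightarrow> ((real \<times> real) \<times> (real \<times> real)) set \<Rightarrow> (real \<times> real) set set \<Rightarrow> bool" where
  "thin_cells_divided \<tau> z G P \<longleftrightarrow>
     (\<forall>(m, w)\<in>G. thin_cell_divided \<tau> P (1, 0) (0, 1) (thin_cell_x z m w) \<and>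
                  thin_cell_divided \<tau> P (0, 1) (1, 0) (thin_cell_y z m w))"

end

theory Submission
  imports Defs
begin

text \<open>Let \<open>q\<close> be a pressure on \<open>\<omega>\<close> with mean \<open>0\<close>, and let \<open>c\<close> and \<open>e\<close> be its means on the small region \<open>\<omega>\<^sub>c\<close>
  and on the edge patch \<open>\<omega>\<^sub>E\<close>. Velocities supported in one of the two regions see only the oscillation
  \<open>q - c\<close> or \<open>q - e\<close>, because the divergence of a field that vanishes on the boundary integrates to zero
  (\<open>divergence_integrals\<close>). So the two assumed inf-sup conditions control the oscillations but not the
  difference of the means. A velocity through the interface does not control it uniformly, since in
  a thin element the seminorm of such a velocity degenerates with the aspect ratio.

  What couples the regions is the continuity of the pressure. At the inner corner \<open>m\<close> of a small
  cell, \<open>q\<close> has a single value, which is close to \<open>c\<close> if \<open>q - c\<close> is small in an element of the small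
  cell, and close to \<open>e\<close> if \<open>q - e\<close> is small in an adjacent thin element. Quantitatively, the square of
  a corner value of a bilinear function times the area of its rectangle is at most 16 times the
  integral of its square (\<open>Q1_corner_bound\<close>). For the comparison with the area of the small cell,
  neither element may be too small. Thin cells are cut lengthwise at most once, in the middle, and
  conformity carries this over to the elements of the small cell at \<open>m\<close>. A thin element is at least as
  long as it is thick, so the thin cell across the longer edge of the small cell is a good choice.
  This gives \<open>small_cell_mean_jump\<close>, with a constant that depends neither on the shape regularity nor
  on the aspect ratios.

  There are at most four small cells, so \<open>\<bar>\<omega>\<^sub>c\<bar> (c - e)\<^sup>2\<close> is bounded by the two squared oscillations,
  and hence so is the squared norm of \<open>q\<close>, which is at most that of \<open>q - e\<close>. The larger of the two
  oscillations is then a fixed fraction of \<open>q\<close>, and a velocity of its region, extended by zero, tests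
  \<open>q\<close> on the whole patch (\<open>inf_sup_from_subdomain\<close>). The resulting constant is
  \<open>min \<beta> \<beta>\<^sub>c / 100\<close>.\<close>

section \<open>Divisions into nondegenerate rectangles\<close>

definition rect_division :: "(real \<times> real) set set \<Rightarrow> (real \<times> real) set \<Rightarrow> bool" where
  "rect_division P D \<longleftrightarrow> P division_of D \<and> (\<forall>K\<in>P. interior K \<noteq> {})"

lemma rect_divisionD:
  assumes "rect_division P D"
  shows "finite P" "D = \<Union>P" "P division_of D"
  using assms division_ofD(1,6) unfolding rect_division_def by metis+

lemma rect_division_cell:
  assumes "rect_division P D" "K \<in> P"
  obtains l u where "K = cbox l u" "fst l < fst u" "snd l < snd u"
proof -
  obtain l u where K: "K = cbox l u"
    using assms division_ofD(4) unfolding rect_division_def by metis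
  moreover have "box l u \<noteq> {}"
    using assms K unfolding rect_division_def by auto
  then have "fst l < fst u" "snd l < snd u"
    unfolding box_ne_empty by (auto simp: Basis_prod_def inner_prod_def)
  ultimately show thesis by (rule that)
qed

lemma rect_division_closed:
  assumes "rect_division P D"
  shows "closed D" "bounded D"
proof -
  have "compact (\<Union>P)"
    using rect_divisionD[OF assms] by (metis assms compact_Union compact_cbox rect_division_cell)
  then show "closed D" "bounded D"
    using rect_divisionD(2)[OF assms] compact_imp_closed compact_imp_bounded by auto
qed

lemma closure_interior_cell:
  assumes "rect_division P D" "K \<in> P"
  shows "closure (interior K) = K"
  using rect_division_cell[OF assms] assms
  by (metis closed_cbox closure_closed convex_box(1) convex_closure_interior rect_division_def)

text \<open>An open set that meets \<open>L\<close> also meets the interior of \<open>L\<close>, because the nondegenerate cell \<open>L\<close> is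
  the closure of its interior.\<close>

lemma interior_Int_other_cell:
  assumes "rect_division P D" "K \<in> P" "L \<in> P" "K \<noteq> L"
  shows "interior K \<inter> L = {}"
proof -
  have "interior K \<inter> interior L = {}"
    using assms division_ofD(5) unfolding rect_division_def by metis
  then show ?thesis
    using open_Int_closure_eq_empty[of "interior K" "interior L"] closure_interior_cell[OF assms(1,3)]
    by simp
qed

text \<open>For \<open>\<C>\<close> the coarse cells and \<open>B\<close> some of them, this makes \<open>\<omega>\<^sub>c\<close>, \<open>\<omega>\<^sub>E\<close> and each single small cell
  unions of elements. Elements outside \<open>\<Union>B\<close> miss the interior of each cell in \<open>B\<close>, so the
  other elements cover that interior, and, their union being closed, the cell.\<close>

lemma Union_refining_cells:
  assumes C: "rect_division \<C> D" and P: "rect_division P D"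
    and refine: "\<forall>K\<in>P. \<exists>L\<in>\<C>. K \<subseteq> L" and B: "B \<subseteq> \<C>"
  shows "\<Union>{K \<in> P. K \<subseteq> \<Union>B} = \<Union>B"
proof
  show "\<Union>B \<subseteq> \<Union>{K \<in> P. K \<subseteq> \<Union>B}"
  proof
    fix x assume "x \<in> \<Union>B"
    then obtain L where L: "L \<in> B" "x \<in> L" by blast
    have "interior L \<inter> K = {}" if "K \<in> P" "\<not> K \<subseteq> \<Union>B" for K
    proof -
      obtain L' where L': "L' \<in> \<C>" "K \<subseteq> L'" using refine \<open>K \<in> P\<close> by blast
      then have "L' \<noteq> L" using that L by blast
      then show ?thesis
        using interior_Int_other_cell[OF C, of L L'] L L' B by blast
    qed
    moreover have "interior L \<subseteq> \<Union>P"
      using L B rect_divisionD(2)[OF C] rect_divisionD(2)[OF P] interior_subset by blast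
    ultimately have "interior L \<subseteq> \<Union>{K \<in> P. K \<subseteq> \<Union>B}" by blast
    moreover have "closed (\<Union>{K \<in> P. K \<subseteq> \<Union>B})"
      using rect_divisionD(1)[OF P] by (intro closed_Union) (auto elim!: rect_division_cell[OF P])
    ultimately have "closure (interior L) \<subseteq> \<Union>{K \<in> P. K \<subseteq> \<Union>B}"
      by (simp add: closure_minimal)
    then show "x \<in> \<Union>{K \<in> P. K \<subseteq> \<Union>B}"
      using closure_interior_cell[OF C, of L] L B by blast
  qed
qed blast

lemma rect_division_restrict:
  assumes P: "rect_division P \<omega>" and D: "\<Union>{K \<in> P. K \<subseteq> D} = D"
  shows "rect_division {K \<in> P. K \<subseteq> D} D"
proof -
  have "P division_of (\<Union>P)" using rect_divisionD(2,3)[OF P] by simp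
  then have "{K \<in> P. K \<subseteq> D} division_of (\<Union>{K \<in> P. K \<subseteq> D})"
    by (rule division_of_subset) simp
  then show ?thesis using P unfolding D rect_division_def by simp
qed

lemma interior_outside_cell:
  assumes P: "rect_division P \<omega>" and D: "\<Union>{K \<in> P. K \<subseteq> D} = D" and K: "K \<in> P" "\<not> K \<subseteq> D"
  shows "interior K \<inter> D = {}"
proof -
  have "interior K \<inter> L = {}" if "L \<in> P" "L \<subseteq> D" for L
    using interior_Int_other_cell[OF P, of K L] that K by blast
  then have "interior K \<inter> \<Union>{K \<in> P. K \<subseteq> D} = {}" by blast
  then show ?thesis using D by simp
qed

lemma negligible_cell_frontiers:
  assumes "rect_division P D"
  shows "negligible (\<Union>K\<in>P. frontier K)"
  using rect_divisionD(1)[OF assms]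
  by (intro negligible_Union) (auto intro!: negligible_convex_frontier elim!: rect_division_cell[OF assms])

lemma rect_division_frontier_subset:
  assumes "rect_division P D"
  shows "frontier D \<subseteq> (\<Union>K\<in>P. frontier K)"
proof
  fix x assume x: "x \<in> frontier D"
  then have "x \<in> D"
    using rect_division_closed(1)[OF assms] frontier_subset_closed by blast
  then obtain K where K: "K \<in> P" "x \<in> K" using rect_divisionD(2)[OF assms] by blast
  have "interior K \<subseteq> interior D"
    using K rect_divisionD(2)[OF assms] by (intro interior_mono) blast
  then have "x \<notin> interior K" using x by (auto simp: frontier_def)
  then have "x \<in> frontier K" using K closure_subset by (auto simp: frontier_def)
  then show "x \<in> (\<Union>K\<in>P. frontier K)" using K by blast
qed

lemma integrable_on_rect_division:
  fixes f :: "real \<times> real \<Rightarrow> real"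
  assumes P: "rect_division P D" and f: "continuous_on D f"
  shows "f integrable_on D"
proof (rule integrable_combine_division[OF rect_divisionD(3)[OF P]])
  fix K assume K: "K \<in> P"
  then have "K \<subseteq> D" using rect_divisionD(2)[OF P] by blast
  moreover obtain l u where "K = cbox l u" using rect_division_cell[OF P K] .
  ultimately show "f integrable_on K"
    using f continuous_on_subset integrable_continuous by blast
qed

section \<open>The divergence integrates to zero\<close>

text \<open>The polynomial on a cell is differentiable on the whole plane. Its partial derivatives serve below
  as continuous representatives of the derivatives of the piecewise polynomial.\<close>

lemma Q_space_smooth_extension:
  assumes "f \<in> Q_space l K"
  shows "\<exists>F F\<^sub>x F\<^sub>y. (\<forall>x\<in>K. f x = F x) \<and> continuous_on UNIV F\<^sub>x \<and> continuous_on UNIV F\<^sub>y \<and>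
    (\<forall>x. (F has_derivative (\<lambda>h. F\<^sub>x x * fst h + F\<^sub>y x * snd h)) (at x))"
proof -
  obtain c where c: "\<forall>x\<in>K. f x = (\<Sum>i\<le>l. \<Sum>j\<le>l. c i j * fst x ^ i * snd x ^ j)"
    using assms unfolding Q_space_def by blast
  define F :: "real \<times> real \<Rightarrow> real" where "F = (\<lambda>x. \<Sum>i\<le>l. \<Sum>j\<le>l. c i j * fst x ^ i * snd x ^ j)"
  define Fx :: "real \<times> real \<Rightarrow> real" where
    "Fx = (\<lambda>x. \<Sum>i\<le>l. \<Sum>j\<le>l. c i j * (of_nat i * fst x ^ (i - 1)) * snd x ^ j)"
  define Fy :: "real \<times> real \<Rightarrow> real" where
    "Fy = (\<lambda>x. \<Sum>i\<le>l. \<Sum>j\<le>l. c i j * fst x ^ i * (of_nat j * snd x ^ (j - 1)))"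
  have "(F has_derivative (\<lambda>h. Fx x * fst h + Fy x * snd h)) (at x)" for x
    unfolding F_def Fx_def Fy_def
    by (auto intro!: derivative_eq_intros
        simp: fun_eq_iff sum_distrib_left sum_distrib_right sum.distrib algebra_simps)
  moreover have "continuous_on UNIV Fx" "continuous_on UNIV Fy"
    unfolding Fx_def Fy_def by (intro continuous_intros)+
  moreover have "\<forall>x\<in>K. f x = F x" using c unfolding F_def by simp
  ultimately show ?thesis by blast
qed

text \<open>Functions that agree near \<open>x\<close> have the same set of derivatives at \<open>x\<close>, even the empty one, and
  \<open>frechet_derivative\<close> is a choice that depends on this set only.\<close>

lemma frechet_derivative_cong_open:
  assumes "open U" "x \<in> U" "\<And>y. y \<in> U \<Longrightarrow> f y = g y"
  shows "frechet_derivative f (at x) = frechet_derivative g (at x)"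
proof -
  have "(f has_derivative f') (at x) \<longleftrightarrow> (g has_derivative f') (at x)" for f'
    using assms has_derivative_transform_within_open by metis
  then show ?thesis unfolding frechet_derivative_def by simp
qed

lemma cell_divergence:
  assumes "(\<lambda>x. fst (v x)) \<in> Q_space l K" "(\<lambda>x. snd (v x)) \<in> Q_space l K"
  obtains g\<^sub>x g\<^sub>y where "continuous_on UNIV g\<^sub>x" "continuous_on UNIV g\<^sub>y"
    "\<And>x. x \<in> interior K \<Longrightarrow> ((\<lambda>s. fst (v (s, snd x))) has_vector_derivative g\<^sub>x x) (at (fst x))"
    "\<And>x. x \<in> interior K \<Longrightarrow> ((\<lambda>s. snd (v (fst x, s))) has_vector_derivative g\<^sub>y x) (at (snd x))"
    "\<And>x. x \<in> interior K \<Longrightarrow> divergence v x = g\<^sub>x x + g\<^sub>y x"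
proof -
  obtain F Fx Fy where F: "\<forall>x\<in>K. fst (v x) = F x"
    "continuous_on UNIV Fx" "continuous_on UNIV Fy"
    "\<And>x. (F has_derivative (\<lambda>h. Fx x * fst h + Fy x * snd h)) (at x)"
    using Q_space_smooth_extension[OF assms(1)] by blast
  obtain H Hx Hy where H: "\<forall>x\<in>K. snd (v x) = H x"
    "continuous_on UNIV Hx" "continuous_on UNIV Hy"
    "\<And>x. (H has_derivative (\<lambda>h. Hx x * fst h + Hy x * snd h)) (at x)"
    using Q_space_smooth_extension[OF assms(2)] by blast
  have K: "interior K \<subseteq> K" "open (interior K)" by (auto simp: interior_subset)
  show thesis
  proof (rule that[OF F(2) H(3)])
    fix x :: "real \<times> real" assume x: "x \<in> interior K"
    have 1: "((\<lambda>x. fst (v x)) has_derivative (\<lambda>h. Fx x * fst h + Fy x * snd h)) (at x)"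
      by (rule has_derivative_transform_within_open[OF F(4) K(2) x]) (use F(1) K(1) in auto)
    have 2: "((\<lambda>x. snd (v x)) has_derivative (\<lambda>h. Hx x * fst h + Hy x * snd h)) (at x)"
      by (rule has_derivative_transform_within_open[OF H(4) K(2) x]) (use H(1) K(1) in auto)
    have "(v has_derivative (\<lambda>h. (Fx x * fst h + Fy x * snd h, Hx x * fst h + Hy x * snd h))) (at x)"
      using has_derivative_Pair[OF 1 2] by simp
    from frechet_derivative_at[OF this, symmetric]
    show "divergence v x = Fx x + Hy x"
      by (simp add: divergence_def Basis_prod_def)
    have "((\<lambda>s. (s, snd x)) has_derivative (\<lambda>h. (h, 0))) (at (fst x))"
      by (auto intro!: derivative_eq_intros)
    from has_derivative_compose[OF this, of "\<lambda>x. fst (v x)" "\<lambda>h. Fx x * fst h + Fy x * snd h"] 1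
    show "((\<lambda>s. fst (v (s, snd x))) has_vector_derivative Fx x) (at (fst x))"
      by (simp add: has_vector_derivative_def mult.commute)
    have "((\<lambda>s. (fst x, s)) has_derivative (\<lambda>h. (0, h))) (at (snd x))"
      by (auto intro!: derivative_eq_intros)
    from has_derivative_compose[OF this, of "\<lambda>x. snd (v x)" "\<lambda>h. Hx x * fst h + Hy x * snd h"] 2
    show "((\<lambda>s. snd (v (fst x, s))) has_vector_derivative Hy x) (at (snd x))"
      by (simp add: has_vector_derivative_def mult.commute)
  qed
qed

text \<open>Along a line \<open>\<iota>\<close>, parallel to an axis and avoiding the
  boundary lines of the cells except at the finitely many parameters in \<open>S\<close>, the function \<open>w\<close> is
  continuous, differentiable off \<open>S\<close> and zero at both ends, so the fundamental theorem of calculus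
  gives the value \<open>0\<close>. The line is left general so that both coordinate directions are covered.\<close>

lemma line_integral_zero:
  fixes w :: "real \<times> real \<Rightarrow> real" and \<iota> :: "real \<Rightarrow> real \<times> real"
  assumes P: "rect_division P D"
    and \<iota>: "continuous_on UNIV \<iota>" and S: "finite S"
    and generic: "\<And>s K. s \<notin> S \<Longrightarrow> K \<in> P \<Longrightarrow> \<iota> s \<in> K \<Longrightarrow> \<iota> s \<in> interior K"
    and bdd: "a \<le> b" "\<And>s. \<iota> s \<in> D \<Longrightarrow> s \<in> {a<..<b}"
    and w: "continuous_on UNIV w" "\<And>x. x \<notin> D \<Longrightarrow> w x = 0"
    and g: "\<And>s K. K \<in> P \<Longrightarrow> \<iota> s \<in> interior K \<Longrightarrow>
              ((\<lambda>s. w (\<iota> s)) has_vector_derivative g K (\<iota> s)) (at s)"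
  shows "integral\<^sup>L lborel (\<lambda>s. \<Sum>K\<in>P. indicator K (\<iota> s) *\<^sub>R g K (\<iota> s)) = 0"
proof -
  define h where "h s = (\<Sum>K\<in>P. indicator K (\<iota> s) *\<^sub>R g K (\<iota> s))" for s
  have out: "h s = 0" "w (\<iota> s) = 0" if "s \<notin> {a<..<b}" for s
  proof -
    have "\<iota> s \<notin> D" using bdd(2) that by blast
    then show "h s = 0" "w (\<iota> s) = 0"
      using w(2) rect_divisionD(2)[OF P] unfolding h_def
      by (auto intro!: sum.neutral simp: indicator_def)
  qed
  \<comment> \<open>off \<open>S\<close> the line is either inside exactly one cell, whose term is the only one in the sum, or
    outside of \<open>D\<close>, where \<open>w\<close> vanishes on a neighbourhood\<close>
  have deriv: "((\<lambda>s. w (\<iota> s)) has_vector_derivative h s) (at s)" if "s \<notin> S" for s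
  proof (cases "\<iota> s \<in> D")
    case True
    then obtain K where K: "K \<in> P" "\<iota> s \<in> K" using rect_divisionD(2)[OF P] by blast
    then have int: "\<iota> s \<in> interior K" using generic that by blast
    have "h s = (\<Sum>L\<in>P. if L = K then g K (\<iota> s) else 0)"
      unfolding h_def
    proof (rule sum.cong)
      fix L assume "L \<in> P"
      then show "indicator L (\<iota> s) *\<^sub>R g L (\<iota> s) = (if L = K then g K (\<iota> s) else 0)"
        using interior_Int_other_cell[OF P K(1), of L] K int by (auto simp: indicator_def)
    qed simp
    then have "h s = g K (\<iota> s)" using K rect_divisionD(1)[OF P] by simp
    then show ?thesis using g[OF K(1) int] by simp
  next
    case False
    then have "h s = 0"
      using rect_divisionD(2)[OF P] unfolding h_def by (auto intro!: sum.neutral simp: indicator_def)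
    moreover have "open (\<iota> -` (- D))"
      using \<iota> rect_division_closed(1)[OF P] by (simp add: open_vimage open_Compl)
    then have "((\<lambda>s. w (\<iota> s)) has_derivative (\<lambda>x. 0)) (at s)"
      using False w(2)
      by (intro has_derivative_transform_within_open[OF has_derivative_const, of "\<iota> -` (- D)" s 0]) auto
    ultimately show ?thesis by (simp add: has_vector_derivative_def)
  qed
  have "continuous_on {a..b} (\<lambda>s. w (\<iota> s))"
    using continuous_on_compose2[OF w(1) \<iota>] continuous_on_subset by blast
  with deriv have "(h has_integral (w (\<iota> b) - w (\<iota> a))) {a..b}"
    by (intro fundamental_theorem_of_calculus_interior_strong[OF S bdd(1)]) auto
  then have "(h has_integral 0) {a..b}" using out(2)[of a] out(2)[of b] by simp
  then have "(h has_integral 0) UNIV"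
    by (rule has_integral_on_superset) (use out(1) in auto)
  then have "integral\<^sup>L lborel h = 0"
    using integral_lborel[of h] integral_unique not_integrable_integral_eq by metis
  then show ?thesis unfolding h_def .
qed

lemma integral_cellwise_eq_lborel:
  fixes g :: "(real \<times> real) set \<Rightarrow> real \<times> real \<Rightarrow> real"
  assumes P: "rect_division P D" and g: "\<And>K. K \<in> P \<Longrightarrow> continuous_on UNIV (g K)"
  shows "integrable lborel (\<lambda>x. \<Sum>K\<in>P. indicator K x *\<^sub>R g K x)"
    and "(\<Sum>K\<in>P. integral K (g K)) = integral\<^sup>L lborel (\<lambda>x. \<Sum>K\<in>P. indicator K x *\<^sub>R g K x)"
proof -
  have i: "integrable lborel (\<lambda>x. indicator K x *\<^sub>R g K x)" if "K \<in> P" for K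
    using g[OF that] rect_division_cell[OF P that]
    by (metis borel_integrable_compact compact_cbox continuous_on_subset top_greatest)
  then show "integrable lborel (\<lambda>x. \<Sum>K\<in>P. indicator K x *\<^sub>R g K x)"
    by auto
  have "integral K (g K) = integral\<^sup>L lborel (\<lambda>x. indicator K x *\<^sub>R g K x)" if "K \<in> P" for K
    using set_borel_integral_eq_integral(2)[of K "g K"] i[OF that]
    unfolding set_integrable_def set_lebesgue_integral_def by simp
  then show "(\<Sum>K\<in>P. integral K (g K)) = integral\<^sup>L lborel (\<lambda>x. \<Sum>K\<in>P. indicator K x *\<^sub>R g K x)"
    using i by (simp add: Bochner_Integration.integral_sum)
qed

lemma interval_bounds_plane:
  fixes l u :: "real \<times> real"
  assumes "fst l \<le> fst u" "snd l \<le> snd u"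
  shows "interval_lowerbound (cbox l u) = l" "interval_upperbound (cbox l u) = u"
  using assms by (auto simp: Basis_prod_def inner_prod_def)

lemma mem_cell_interior:
  assumes "rect_division P D" "K \<in> P" "x \<in> K"
    "fst x \<notin> fst ` (interval_lowerbound ` P \<union> interval_upperbound ` P)"
    "snd x \<notin> snd ` (interval_lowerbound ` P \<union> interval_upperbound ` P)"
  shows "x \<in> interior K"
proof -
  obtain l u where K: "K = cbox l u" "fst l < fst u" "snd l < snd u"
    using rect_division_cell[OF assms(1,2)] .
  then have "interval_lowerbound K = l" "interval_upperbound K = u"
    by (simp_all add: interval_bounds_plane)
  then have "fst x \<noteq> fst l" "fst x \<noteq> fst u" "snd x \<noteq> snd l" "snd x \<noteq> snd u"
    using assms(2,4,5) by (auto simp: image_iff)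
  then show ?thesis
    using assms(3) unfolding K(1) by (auto simp: mem_box Basis_prod_def inner_prod_def)
qed

text \<open>Fubini reduces the claim to horizontal lines. Only the finitely many ones that contain an edge are
  not covered by \<open>line_integral_zero\<close>, and they do not matter for the outer integral.\<close>

lemma integral_cellwise_x_derivative:
  assumes P: "rect_division P D"
    and w: "continuous_on UNIV w" "\<And>x. x \<notin> D \<Longrightarrow> w x = (0::real)"
    and g: "\<And>K. K \<in> P \<Longrightarrow> continuous_on UNIV (g K)"
      "\<And>x K. K \<in> P \<Longrightarrow> x \<in> interior K \<Longrightarrow>
         ((\<lambda>s. w (s, snd x)) has_vector_derivative g K x) (at (fst x))"
  shows "(\<Sum>K\<in>P. integral K (g K)) = 0"
proof -
  define G where "G x = (\<Sum>K\<in>P. indicator K x *\<^sub>R g K x)" for x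
  define E where "E = interval_lowerbound ` P \<union> interval_upperbound ` P"
  obtain r where r: "r > 0" "\<And>x. x \<in> D \<Longrightarrow> norm x < r"
    using rect_division_closed(2)[OF P] bounded_pos_less by metis
  have "finite E" using rect_divisionD(1)[OF P] unfolding E_def by simp
  then have fin: "finite (fst ` E)" "finite (snd ` E)" by auto
  have line: "integral\<^sup>L lborel (\<lambda>s. G (s, y)) = 0" if y: "y \<notin> snd ` E" for y
    unfolding G_def
  proof (rule line_integral_zero[OF P _ fin(1) _ _ _ w, where a = "-r" and b = r])
    show "s \<in> {-r<..<r}" if "(s, y) \<in> D" for s
      using r(2)[OF that] norm_fst_le[of s y] by auto
    show "(s, y) \<in> interior K" if "s \<notin> fst ` E" "K \<in> P" "(s, y) \<in> K" for s K
      using mem_cell_interior[OF P that(2,3)] that(1) y unfolding E_def by simp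
    show "((\<lambda>s. w (s, y)) has_vector_derivative g K (s, y)) (at s)"
      if "K \<in> P" "(s, y) \<in> interior K" for s K
      using g(2)[OF that] by simp
  qed (use r(1) in \<open>auto intro!: continuous_intros\<close>)
  have eta: "case_prod (\<lambda>s y. G (s, y)) = G" by auto
  have int: "integrable (lborel \<Otimes>\<^sub>M lborel) (case_prod (\<lambda>s y. G (s, y)))"
    unfolding eta unfolding G_def lborel_prod
    by (rule integral_cellwise_eq_lborel(1)[OF P]) (rule g(1))
  have "AE y in lborel. y \<notin> snd ` E"
    using fin(2) by (intro AE_not_in finite_imp_null_set_lborel)
  then have "AE y in lborel. integral\<^sup>L lborel (\<lambda>s. G (s, y)) = 0"
    by (rule AE_mp) (use line in auto)
  then have "(\<integral>y. (\<integral>s. G (s, y) \<partial>lborel) \<partial>lborel) = 0"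
    by (rule integral_eq_zero_AE)
  then have "integral\<^sup>L (lborel \<Otimes>\<^sub>M lborel) (case_prod (\<lambda>s y. G (s, y))) = 0"
    using lborel_pair.integral_snd[OF int] by simp
  then show ?thesis
    using integral_cellwise_eq_lborel(2)[of P D g, OF P g(1)] unfolding eta
    unfolding G_def lborel_prod by simp
qed

lemma integral_cellwise_y_derivative:
  assumes P: "rect_division P D"
    and w: "continuous_on UNIV w" "\<And>x. x \<notin> D \<Longrightarrow> w x = (0::real)"
    and g: "\<And>K. K \<in> P \<Longrightarrow> continuous_on UNIV (g K)"
      "\<And>x K. K \<in> P \<Longrightarrow> x \<in> interior K \<Longrightarrow>
         ((\<lambda>s. w (fst x, s)) has_vector_derivative g K x) (at (snd x))"
  shows "(\<Sum>K\<in>P. integral K (g K)) = 0"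
proof -
  define G where "G x = (\<Sum>K\<in>P. indicator K x *\<^sub>R g K x)" for x
  define E where "E = interval_lowerbound ` P \<union> interval_upperbound ` P"
  obtain r where r: "r > 0" "\<And>x. x \<in> D \<Longrightarrow> norm x < r"
    using rect_division_closed(2)[OF P] bounded_pos_less by metis
  have "finite E" using rect_divisionD(1)[OF P] unfolding E_def by simp
  then have fin: "finite (fst ` E)" "finite (snd ` E)" by auto
  have line: "integral\<^sup>L lborel (\<lambda>s. G (y, s)) = 0" if y: "y \<notin> fst ` E" for y
    unfolding G_def
  proof (rule line_integral_zero[OF P _ fin(2) _ _ _ w, where a = "-r" and b = r])
    show "s \<in> {-r<..<r}" if "(y, s) \<in> D" for s
      using r(2)[OF that] norm_snd_le[of s y] by auto
    show "(y, s) \<in> interior K" if "s \<notin> snd ` E" "K \<in> P" "(y, s) \<in> K" for s K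
      using mem_cell_interior[OF P that(2,3)] that(1) y unfolding E_def by simp
    show "((\<lambda>s. w (y, s)) has_vector_derivative g K (y, s)) (at s)"
      if "K \<in> P" "(y, s) \<in> interior K" for s K
      using g(2)[OF that] by simp
  qed (use r(1) in \<open>auto intro!: continuous_intros\<close>)
  have eta: "case_prod (\<lambda>y s. G (y, s)) = G" by auto
  have int: "integrable (lborel \<Otimes>\<^sub>M lborel) (case_prod (\<lambda>y s. G (y, s)))"
    unfolding eta unfolding G_def lborel_prod
    by (rule integral_cellwise_eq_lborel(1)[OF P]) (rule g(1))
  have "AE y in lborel. y \<notin> fst ` E"
    using fin(1) by (intro AE_not_in finite_imp_null_set_lborel)
  then have "AE y in lborel. integral\<^sup>L lborel (\<lambda>s. G (y, s)) = 0"
    by (rule AE_mp) (use line in auto)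
  then have "(\<integral>y. (\<integral>s. G (y, s) \<partial>lborel) \<partial>lborel) = 0"
    by (rule integral_eq_zero_AE)
  then have "integral\<^sup>L (lborel \<Otimes>\<^sub>M lborel) (case_prod (\<lambda>y s. G (y, s))) = 0"
    using lborel_pair.integral_fst[OF int] by simp
  then show ?thesis
    using integral_cellwise_eq_lborel(2)[of P D g, OF P g(1)] unfolding eta
    unfolding G_def lborel_prod by simp
qed

text \<open>The function \<open>divergence v\<close> is only known in the interior of the cells. Since the cell boundaries
  are null sets, it can be replaced there by the continuous functions \<open>g K + h K\<close>.\<close>

lemma divergence_integrals:
  assumes P: "rect_division P D"
    and v: "continuous_on UNIV v" "\<And>x. x \<notin> D \<Longrightarrow> v x = 0"
      "\<And>K. K \<in> P \<Longrightarrow> (\<lambda>x. fst (v x)) \<in> Q_space l K \<and> (\<lambda>x. snd (v x)) \<in> Q_space l K"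
  shows "integral D (divergence v) = 0"
    and "continuous_on D q \<Longrightarrow> (\<lambda>x. q x * divergence v x) integrable_on D"
proof -
  define R where "R K g h \<longleftrightarrow> continuous_on UNIV g \<and> continuous_on UNIV h \<and>
      (\<forall>x\<in>interior K. ((\<lambda>s. fst (v (s, snd x))) has_vector_derivative g x) (at (fst x)) \<and>
        ((\<lambda>s. snd (v (fst x, s))) has_vector_derivative h x) (at (snd x)) \<and>
        divergence v x = g x + h x)" for K g h
  have "\<exists>g h. R K g h" if "K \<in> P" for K
    unfolding R_def by (rule cell_divergence[of v l K]) (use v(3)[OF that] in blast)+
  then obtain g h where gh: "\<And>K. K \<in> P \<Longrightarrow> R K (g K) (h K)"
    by metis
  note gh = gh[unfolded R_def, THEN conjunct1] gh[unfolded R_def, THEN conjunct2, THEN conjunct1]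
    gh[unfolded R_def, THEN conjunct2, THEN conjunct2, THEN bspec, THEN conjunct1]
    gh[unfolded R_def, THEN conjunct2, THEN conjunct2, THEN bspec, THEN conjunct2, THEN conjunct1]
    gh[unfolded R_def, THEN conjunct2, THEN conjunct2, THEN bspec, THEN conjunct2, THEN conjunct2]
  have neg: "negligible (frontier K)" if "K \<in> P" for K
    using that by (auto intro!: negligible_convex_frontier elim!: rect_division_cell[OF P])
  have off: "divergence v x = g K x + h K x" if "K \<in> P" "x \<in> K - frontier K" for x K
  proof (rule gh(5)[OF that(1)])
    show "x \<in> interior K" using that(2) closure_subset[of K] by (auto simp: frontier_def)
  qed
  have ci: "f integrable_on K" if "K \<in> P" "continuous_on UNIV f" for K and f :: "real \<times> real \<Rightarrow> real"
    using that continuous_on_subset by (auto elim!: rect_division_cell[OF P] intro!: integrable_continuous)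
  have "(divergence v has_integral (integral K (g K) + integral K (h K))) K" if K: "K \<in> P" for K
    by (rule has_integral_spike[OF neg[OF K] off[OF K] has_integral_add])
       (use K gh ci in \<open>auto intro!: integrable_integral\<close>)
  then have "(divergence v has_integral (\<Sum>K\<in>P. integral K (g K) + integral K (h K))) D"
    by (rule has_integral_combine_division[OF rect_divisionD(3)[OF P]])
  moreover have "(\<Sum>K\<in>P. integral K (g K)) = 0"
    by (rule integral_cellwise_x_derivative[OF P _ _ gh(1) gh(3)])
       (auto intro!: continuous_intros v(1) simp: v(2))
  moreover have "(\<Sum>K\<in>P. integral K (h K)) = 0"
    by (rule integral_cellwise_y_derivative[OF P _ _ gh(2) gh(4)])
       (auto intro!: continuous_intros v(1) simp: v(2))
  ultimately show "integral D (divergence v) = 0"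
    by (simp add: sum.distrib integral_unique)
  show "(\<lambda>x. q x * divergence v x) integrable_on D" if q: "continuous_on D q"
  proof (rule integrable_combine_division[OF rect_divisionD(3)[OF P]])
    fix K assume K: "K \<in> P"
    then have "continuous_on K q"
      using q rect_divisionD(2)[OF P] continuous_on_subset by blast
    then have "continuous_on K (\<lambda>x. q x * (g K x + h K x))"
      using gh(1,2)[OF K] by (intro continuous_intros) (auto intro: continuous_on_subset)
    then have "(\<lambda>x. q x * (g K x + h K x)) integrable_on K"
      using K by (auto elim!: rect_division_cell[OF P] intro!: integrable_continuous)
    then show "(\<lambda>x. q x * divergence v x) integrable_on K"
      by (rule integrable_spike[OF _ neg[OF K]]) (use off[OF K] in auto)
  qed
qed

section \<open>Extending velocities from a subregion by zero\<close>

definition extend_zero :: "(real \<times> real) set \<Rightarrow> (real \<times> real \<Rightarrow> real \<times> real) \<Rightarrow> real \<times> real \<Rightarrow> real \<times> real" where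
  "extend_zero D v x = (if x \<in> D then v x else 0)"

lemma continuous_extend_zero:
  assumes "closed D" "continuous_on D v" "\<forall>x\<in>frontier D. v x = 0"
  shows "continuous_on UNIV (extend_zero D v)"
proof -
  have "continuous_on (D \<union> closure (- D)) (\<lambda>x. if x \<in> D then v x else 0)"
  proof (rule continuous_on_cases)
    show "\<forall>x. x \<in> D \<and> x \<notin> D \<or> x \<in> closure (- D) \<and> x \<in> D \<longrightarrow> v x = 0"
      using assms(1,3) by (auto simp: frontier_closures)
  qed (use assms in auto)
  moreover have "D \<union> closure (- D) = UNIV" using closure_subset[of "- D"] by auto
  ultimately show ?thesis unfolding extend_zero_def by simp
qed

text \<open>A cell not contained in \<open>D\<close> meets \<open>D\<close> only in boundary points of \<open>D\<close>, where \<open>v\<close> vanishes, so the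
  extension is the zero polynomial on that whole closed cell.\<close>

lemma extend_zero_in_V_space:
  assumes P: "rect_division P \<omega>" and D: "\<Union>{K \<in> P. K \<subseteq> D} = D" and v: "v \<in> V_space P D"
  shows "extend_zero D v \<in> V_space P \<omega>"
proof -
  have cl: "closed D" using rect_division_closed(1)[OF rect_division_restrict[OF P D]] .
  have v0: "v x = 0" if "x \<in> frontier D" for x using v that unfolding V_space_def by blast
  have cont: "continuous_on UNIV (extend_zero D v)"
    using v unfolding V_space_def by (intro continuous_extend_zero[OF cl]) auto
  have "D \<subseteq> \<omega>" using D rect_divisionD(2)[OF P] by blast
  then have "extend_zero D v x = 0" if "x \<in> frontier \<omega>" for x
    using v0[of x] closure_mono[of "- \<omega>" "- D"] closure_subset[of D] that
    unfolding extend_zero_def by (auto simp: frontier_closures)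
  moreover have "(\<lambda>x. fst (extend_zero D v x)) \<in> Q_space 2 K \<and>
      (\<lambda>x. snd (extend_zero D v x)) \<in> Q_space 2 K" if K: "K \<in> P" for K
  proof (cases "K \<subseteq> D")
    case True
    then have "(\<lambda>x. fst (v x)) \<in> Q_space 2 K \<and> (\<lambda>x. snd (v x)) \<in> Q_space 2 K"
      using v K unfolding V_space_def by blast
    moreover have "extend_zero D v x = v x" if "x \<in> K" for x
      using True that unfolding extend_zero_def by auto
    ultimately show ?thesis unfolding Q_space_def by simp
  next
    case False
    have z: "extend_zero D v x = 0" if x: "x \<in> K" for x
    proof (cases "x \<in> D")
      case True
      have "interior K \<subseteq> - D" using interior_outside_cell[OF P D K False] by blast
      then have "x \<in> closure (- D)"
        using closure_mono closure_interior_cell[OF P K] x by blast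
      then show ?thesis
        using True v0[of x] closure_subset[of D] unfolding extend_zero_def by (auto simp: frontier_closures)
    qed (simp add: extend_zero_def)
    have "\<exists>c :: nat \<Rightarrow> nat \<Rightarrow> real. \<forall>x\<in>K. 0 = (\<Sum>i\<le>2. \<Sum>j\<le>2. c i j * fst x ^ i * snd x ^ j)"
      by (rule exI[of _ "\<lambda>_ _. 0"]) simp
    then show ?thesis using z unfolding Q_space_def by simp
  qed
  ultimately show ?thesis
    using continuous_on_subset[OF cont] unfolding V_space_def by auto
qed

lemma integral_vanishing_outside:
  fixes f g :: "real \<times> real \<Rightarrow> real"
  assumes P: "rect_division P \<omega>" and D: "\<Union>{K \<in> P. K \<subseteq> D} = D"
    and f: "\<And>x. x \<in> interior D \<Longrightarrow> f x = g x" "\<And>x. x \<notin> D \<Longrightarrow> f x = 0"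
  shows "integral \<omega> f = integral D g"
proof -
  have RD: "rect_division {K \<in> P. K \<subseteq> D} D" using rect_division_restrict[OF P D] .
  have neg: "negligible (frontier D)"
    using negligible_subset[OF negligible_cell_frontiers[OF RD] rect_division_frontier_subset[OF RD]] .
  have sub: "D \<subseteq> \<omega>" using D rect_divisionD(2)[OF P] by blast
  have "integral \<omega> f = integral \<omega> (\<lambda>x. if x \<in> D then g x else 0)"
  proof (rule integral_spike[OF neg])
    fix x assume "x \<in> \<omega> - frontier D"
    then have "x \<in> D \<Longrightarrow> x \<in> interior D" using closure_subset[of D] by (auto simp: frontier_def)
    then show "(if x \<in> D then g x else 0) = f x" by (cases "x \<in> D") (simp_all add: f)
  qed
  also have "\<dots> = integral D g"
    using sub by (simp add: integral_restrict_Int Int_absorb2 Int_absorb1)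
  finally show ?thesis .
qed

lemma frechet_derivative_extend_zero:
  assumes "closed D"
  shows "x \<in> interior D \<Longrightarrow> frechet_derivative (extend_zero D v) (at x) = frechet_derivative v (at x)"
    and "x \<notin> D \<Longrightarrow> frechet_derivative (extend_zero D v) (at x) = (\<lambda>_. 0)"
proof -
  show "frechet_derivative (extend_zero D v) (at x) = frechet_derivative v (at x)" if "x \<in> interior D"
    by (rule frechet_derivative_cong_open[OF open_interior that])
       (use interior_subset in \<open>auto simp: extend_zero_def\<close>)
  show "frechet_derivative (extend_zero D v) (at x) = (\<lambda>_. 0)" if "x \<notin> D"
  proof -
    have "frechet_derivative (extend_zero D v) (at x) = frechet_derivative (\<lambda>_. 0) (at x)"
      by (rule frechet_derivative_cong_open[of "- D"]) (use assms that in \<open>auto simp: extend_zero_def\<close>)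
    then show ?thesis by simp
  qed
qed

definition average :: "(real \<times> real) set \<Rightarrow> (real \<times> real \<Rightarrow> real) \<Rightarrow> real" where
  "average D q = integral D q / integral D (\<lambda>_. 1)"

lemma integral_one_pos:
  assumes P: "rect_division P D" and "P \<noteq> {}"
  shows "integral D (\<lambda>_. 1 :: real) > 0"
proof -
  obtain K where K: "K \<in> P" using assms(2) by blast
  obtain l u where lu: "K = cbox l u" "fst l < fst u" "snd l < snd u"
    using rect_division_cell[OF P K] .
  have "integral K (\<lambda>_. 1 :: real) = (fst u - fst l) * (snd u - snd l)"
    using lu by (simp add: content_cbox' Basis_prod_def inner_prod_def box_ne_empty content_cbox_if)
  moreover have "integral K (\<lambda>_. 1 :: real) \<le> integral D (\<lambda>_. 1)"
  proof (rule integral_subset_le)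
    show "K \<subseteq> D" using K rect_divisionD(2)[OF P] by blast
    show "(\<lambda>_. 1 :: real) integrable_on K" using lu by (auto intro!: integrable_continuous)
    show "(\<lambda>_. 1 :: real) integrable_on D" by (rule integrable_on_rect_division[OF P]) simp
  qed auto
  ultimately show ?thesis using lu by (smt (verit) mult_pos_pos)
qed

lemma Q1_minus_const:
  assumes "q \<in> Q_space 1 K"
  shows "(\<lambda>x. q x - m) \<in> Q_space 1 K"
proof -
  obtain c :: "nat \<Rightarrow> nat \<Rightarrow> real" where
    c: "\<forall>x\<in>K. q x = (\<Sum>i\<le>1. \<Sum>j\<le>1. c i j * fst x ^ i * snd x ^ j)"
    using assms unfolding Q_space_def by blast
  define c' where "c' i j = (if i = 0 \<and> j = 0 then c i j - m else c i j)" for i j :: nat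
  have "\<forall>x\<in>K. q x - m = (\<Sum>i\<le>1. \<Sum>j\<le>1. c' i j * fst x ^ i * snd x ^ j)"
    using c by (simp add: c'_def)
  then show ?thesis unfolding Q_space_def by blast
qed

lemma minus_average_in_M_space:
  assumes P: "rect_division P \<omega>" and D: "\<Union>{K \<in> P. K \<subseteq> D} = D" "D \<noteq> {}" and q: "q \<in> M_space P \<omega>"
  shows "(\<lambda>x. q x - average D q) \<in> M_space P D"
proof -
  have RD: "rect_division {K \<in> P. K \<subseteq> D} D" using rect_division_restrict[OF P D(1)] .
  have sub: "D \<subseteq> \<omega>" using D rect_divisionD(2)[OF P] by blast
  then have cont: "continuous_on D q" using q continuous_on_subset unfolding M_space_def by blast
  have "integral D (\<lambda>_. 1 :: real) > 0" using D by (intro integral_one_pos[OF RD]) auto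
  moreover have "integral D (\<lambda>x. q x - average D q) = integral D q - average D q * integral D (\<lambda>_. 1)"
    using integrable_on_rect_division[OF RD cont] integrable_on_rect_division[OF RD, of "\<lambda>_. average D q"]
      integral_mult_right[of D "average D q" "\<lambda>_. 1 :: real"]
    by (simp add: integral_diff)
  ultimately have "integral D (\<lambda>x. q x - average D q) = 0" by (simp add: average_def)
  then show ?thesis
    using q sub cont Q1_minus_const unfolding M_space_def by (auto intro!: continuous_intros)
qed

text \<open>This is where the mean value of the pressure on a subregion becomes invisible to the velocities
  supported there; it is the reason that the two subregions must be coupled separately.\<close>

lemma integral_divergence_minus_const:
  assumes P: "rect_division P \<omega>" and D: "\<Union>{K \<in> P. K \<subseteq> D} = D"
    and v: "v \<in> V_space P D" and q: "continuous_on D q"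
  shows "integral D (\<lambda>x. (q x - m) * divergence v x) = integral D (\<lambda>x. q x * divergence v x)"
proof -
  have RD: "rect_division {K \<in> P. K \<subseteq> D} D" using rect_division_restrict[OF P D] .
  define w where "w = extend_zero D v"
  have cl: "closed D" using rect_division_closed(1)[OF RD] .
  have cont: "continuous_on UNIV w"
    using v unfolding V_space_def w_def by (intro continuous_extend_zero[OF cl]) auto
  have w0: "w x = 0" if "x \<notin> D" for x using that by (simp add: w_def extend_zero_def)
  have Q: "(\<lambda>x. fst (w x)) \<in> Q_space 2 K \<and> (\<lambda>x. snd (w x)) \<in> Q_space 2 K"
    if "K \<in> {K \<in> P. K \<subseteq> D}" for K
  proof -
    have "K \<subseteq> \<omega>" using that rect_divisionD(2)[OF P] by blast
    then show ?thesis
      using extend_zero_in_V_space[OF P D v] that unfolding V_space_def w_def by blast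
  qed
  note div = divergence_integrals[OF RD cont w0 Q]
  have swap: "integral D (\<lambda>x. p x * divergence v x) = integral D (\<lambda>x. p x * divergence w x)" for p
  proof (rule integral_spike)
    show "negligible (frontier D)"
      using negligible_subset[OF negligible_cell_frontiers[OF RD] rect_division_frontier_subset[OF RD]] .
    fix x assume "x \<in> D - frontier D"
    then have "x \<in> interior D" using closure_subset[of D] by (auto simp: frontier_def)
    then show "p x * divergence w x = p x * divergence v x"
      using frechet_derivative_extend_zero(1)[OF cl] by (simp add: divergence_def w_def)
  qed
  have "integral D (\<lambda>x. (q x - m) * divergence w x) =
      integral D (\<lambda>x. q x * divergence w x) - integral D (\<lambda>x. m * divergence w x)"
    unfolding left_diff_distrib using q by (intro integral_diff div(2)) auto
  then show ?thesis unfolding swap using div(1) by simp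
qed

lemma L2_norm_on_nonneg: "0 \<le> L2_norm_on D r"
proof (cases "(\<lambda>x. (r x)\<^sup>2) integrable_on D")
  case True
  then show ?thesis unfolding L2_norm_on_def by (simp add: integral_nonneg)
next
  case False
  then show ?thesis unfolding L2_norm_on_def by (simp add: not_integrable_integral)
qed

text \<open>If the oscillation of \<open>q\<close> around its mean on \<open>D\<close> is a fixed fraction of \<open>q\<close>, then a velocity that
  is good for this oscillation on \<open>D\<close> is, after extension by zero, good for \<open>q\<close> on \<open>\<omega>\<close>: numerator
  and seminorm do not change. The factor \<open>1/2\<close> pays for the supremum on \<open>D\<close> not being attained.\<close>

lemma inf_sup_from_subdomain:
  assumes P: "rect_division P \<omega>" and D: "\<Union>{K \<in> P. K \<subseteq> D} = D" "D \<noteq> {}"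
    and stable: "inf_sup_stable P D b" "b > 0"
    and q: "q \<in> M_space P \<omega>"
    and c: "c \<ge> 0" and pos: "L2_norm_on \<omega> q > 0"
    and dom: "c * L2_norm_on \<omega> q \<le> L2_norm_on D (\<lambda>x. q x - average D q)"
    and nz: "\<exists>x\<in>D. q x - average D q \<noteq> 0"
  shows "ereal (b / 2 * c) \<le> (SUP v \<in> {v \<in> V_space P \<omega>. \<exists>x\<in>\<omega>. v x \<noteq> 0}.
    ereal (integral \<omega> (\<lambda>x. q x * divergence v x) / (H1_seminorm_on \<omega> v * L2_norm_on \<omega> q)))"
proof -
  define r where "r x = q x - average D q" for x
  have RD: "rect_division {K \<in> P. K \<subseteq> D} D" using rect_division_restrict[OF P D(1)] .
  have cl: "closed D" using rect_division_closed(1)[OF RD] .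
  have sub: "D \<subseteq> \<omega>" using D rect_divisionD(2)[OF P] by blast
  then have cont: "continuous_on D q" using q continuous_on_subset unfolding M_space_def by blast
  have r: "r \<in> {r \<in> M_space P D. \<exists>x\<in>D. r x \<noteq> 0}"
    using minus_average_in_M_space[OF P D q] nz unfolding r_def by simp
  have "ereal (b / 2) < ereal b" using stable(2) by simp
  also have "\<dots> \<le> inf_sup P D" using stable(1) unfolding inf_sup_stable_def .
  also have "\<dots> \<le> (SUP v \<in> {v \<in> V_space P D. \<exists>x\<in>D. v x \<noteq> 0}.
      ereal (integral D (\<lambda>x. r x * divergence v x) / (H1_seminorm_on D v * L2_norm_on D r)))"
    unfolding inf_sup_def by (rule INF_lower[OF r])
  finally have "ereal (b / 2) < (SUP v \<in> {v \<in> V_space P D. \<exists>x\<in>D. v x \<noteq> 0}.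
      ereal (integral D (\<lambda>x. r x * divergence v x) / (H1_seminorm_on D v * L2_norm_on D r)))" .
  then obtain v where v': "v \<in> {v \<in> V_space P D. \<exists>x\<in>D. v x \<noteq> 0}"
    and bound': "ereal (b / 2) <
      ereal (integral D (\<lambda>x. r x * divergence v x) / (H1_seminorm_on D v * L2_norm_on D r))"
    unfolding less_SUP_iff by (elim bexE)
  have v: "v \<in> V_space P D" "\<exists>x\<in>D. v x \<noteq> 0" using v' by simp_all
  have bound: "b / 2 < integral D (\<lambda>x. r x * divergence v x) / (H1_seminorm_on D v * L2_norm_on D r)"
    using bound' by (simp only: less_ereal.simps(1))
  define w where "w = extend_zero D v"
  have w: "w \<in> {v \<in> V_space P \<omega>. \<exists>x\<in>\<omega>. v x \<noteq> 0}"
    using extend_zero_in_V_space[OF P D(1) v(1)] v(2) sub unfolding w_def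
    by (auto simp: extend_zero_def)
  have "integral \<omega> (\<lambda>x. q x * divergence w x) = integral D (\<lambda>x. q x * divergence v x)"
    by (rule integral_vanishing_outside[OF P D(1)])
       (simp_all add: divergence_def w_def frechet_derivative_extend_zero[OF cl])
  also have "\<dots> = integral D (\<lambda>x. r x * divergence v x)"
    unfolding r_def using integral_divergence_minus_const[OF P D(1) v(1) cont] by simp
  finally have num: "integral \<omega> (\<lambda>x. q x * divergence w x) = integral D (\<lambda>x. r x * divergence v x)" .
  have H1: "H1_seminorm_on \<omega> w = H1_seminorm_on D v"
    unfolding H1_seminorm_on_def
    by (subst integral_vanishing_outside[OF P D(1)])
       (auto simp add: w_def frechet_derivative_extend_zero[OF cl])
  define X where "X = integral D (\<lambda>x. r x * divergence v x) / H1_seminorm_on D v"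
  have "0 \<le> L2_norm_on D r" by (rule L2_norm_on_nonneg)
  moreover have X: "b / 2 < X / L2_norm_on D r" using bound by (simp add: X_def)
  ultimately have "L2_norm_on D r > 0" using stable(2) by (cases "L2_norm_on D r = 0") auto
  then have "b / 2 * L2_norm_on D r \<le> X" using X by (simp add: pos_less_divide_eq)
  moreover have "b / 2 * (c * L2_norm_on \<omega> q) \<le> b / 2 * L2_norm_on D r"
    using dom stable(2) unfolding r_def[abs_def] by (intro mult_left_mono) auto
  ultimately have "b / 2 * c \<le> X / L2_norm_on \<omega> q" using pos by (simp add: pos_le_divide_eq mult.assoc)
  then have "ereal (b / 2 * c) \<le> ereal (integral \<omega> (\<lambda>x. q x * divergence w x) / (H1_seminorm_on \<omega> w * L2_norm_on \<omega> q))"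
    unfolding num H1 X_def by simp
  also have "\<dots> \<le> (SUP v \<in> {v \<in> V_space P \<omega>. \<exists>x\<in>\<omega>. v x \<noteq> 0}.
    ereal (integral \<omega> (\<lambda>x. q x * divergence v x) / (H1_seminorm_on \<omega> v * L2_norm_on \<omega> q)))"
    by (rule SUP_upper[OF w])
  finally show ?thesis .
qed

section \<open>Corner values of bilinear functions\<close>

text \<open>The constant 4 is optimal. The difference of the two sides is \<open>(d - c) / 3\<close> times a square.\<close>

lemma linear_endpoint_bound:
  fixes \<alpha> \<gamma> c d p :: real
  assumes "c \<le> d" "p = c \<or> p = d"
  shows "(d - c) * (\<alpha> + \<gamma> * p)\<^sup>2 \<le> 4 * integral {c..d} (\<lambda>s. (\<alpha> + \<gamma> * s)\<^sup>2)"
proof -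
  have "((\<lambda>s. (\<alpha> + \<gamma> * s)\<^sup>2) has_integral
      ((\<alpha>\<^sup>2 * d + \<alpha> * \<gamma> * d\<^sup>2 + \<gamma>\<^sup>2 * d ^ 3 / 3) - (\<alpha>\<^sup>2 * c + \<alpha> * \<gamma> * c\<^sup>2 + \<gamma>\<^sup>2 * c ^ 3 / 3))) {c..d}"
    by (rule fundamental_theorem_of_calculus[OF assms(1)])
       (auto intro!: derivative_eq_intros simp flip: has_real_derivative_iff_has_vector_derivative
          simp: power2_eq_square algebra_simps)
  then have I: "integral {c..d} (\<lambda>s. (\<alpha> + \<gamma> * s)\<^sup>2) =
      (\<alpha>\<^sup>2 * d + \<alpha> * \<gamma> * d\<^sup>2 + \<gamma>\<^sup>2 * d ^ 3 / 3) - (\<alpha>\<^sup>2 * c + \<alpha> * \<gamma> * c\<^sup>2 + \<gamma>\<^sup>2 * c ^ 3 / 3)"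
    by (rule integral_unique)
  have "0 \<le> (d - c) * (3 * (\<alpha> + \<gamma> * c) + 2 * \<gamma> * (d - c))\<^sup>2 / 3"
    "0 \<le> (d - c) * (3 * (\<alpha> + \<gamma> * d) - 2 * \<gamma> * (d - c))\<^sup>2 / 3"
    using assms(1) by auto
  moreover have "4 * integral {c..d} (\<lambda>s. (\<alpha> + \<gamma> * s)\<^sup>2) - (d - c) * (\<alpha> + \<gamma> * c)\<^sup>2 =
      (d - c) * (3 * (\<alpha> + \<gamma> * c) + 2 * \<gamma> * (d - c))\<^sup>2 / 3"
    unfolding I by (simp add: field_simps power2_eq_square power3_eq_cube)
  moreover have "4 * integral {c..d} (\<lambda>s. (\<alpha> + \<gamma> * s)\<^sup>2) - (d - c) * (\<alpha> + \<gamma> * d)\<^sup>2 =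
      (d - c) * (3 * (\<alpha> + \<gamma> * d) - 2 * \<gamma> * (d - c))\<^sup>2 / 3"
    unfolding I by (simp add: field_simps power2_eq_square power3_eq_cube)
  ultimately show ?thesis using assms(2) by auto
qed

text \<open>The one-dimensional bound, applied first in the second and then in the first variable.\<close>

lemma Q1_corner_bound:
  assumes lu: "fst l \<le> fst u" "snd l \<le> snd u"
    and p: "fst p = fst l \<or> fst p = fst u" "snd p = snd l \<or> snd p = snd u"
    and f: "f \<in> Q_space 1 (cbox l u)"
  shows "(fst u - fst l) * (snd u - snd l) * (f p)\<^sup>2 \<le> 16 * integral (cbox l u) (\<lambda>x. (f x)\<^sup>2)"
proof -
  obtain k :: "nat \<Rightarrow> nat \<Rightarrow> real" where
    k: "\<forall>x\<in>cbox l u. f x = (\<Sum>i\<le>1. \<Sum>j\<le>1. k i j * fst x ^ i * snd x ^ j)"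
    using f unfolding Q_space_def by blast
  define F where "F s t = k 0 0 + k 0 1 * t + k 1 0 * s + k 1 1 * s * t" for s t
  have fF: "f x = F (fst x) (snd x)" if "x \<in> cbox l u" for x
    using k that by (simp add: F_def)
  obtain a c b d where l: "l = (a, c)" and u: "u = (b, d)" by (metis surj_pair)
  define s0 where "s0 = fst p"
  define t0 where "t0 = snd p"
  have le: "a \<le> b" "c \<le> d" using lu unfolding l u by auto
  have pm: "p \<in> cbox l u" using p lu by (auto simp: mem_box Basis_prod_def inner_prod_def)
  have "continuous_on (cbox (a, c) (b, d)) (\<lambda>x. (F (fst x) (snd x))\<^sup>2)"
    unfolding F_def by (intro continuous_intros)
  then have "integral (cbox l u) (\<lambda>x. (F (fst x) (snd x))\<^sup>2) =
      integral {a..b} (\<lambda>s. integral {c..d} (\<lambda>t. (F s t)\<^sup>2))"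
    unfolding l u by (subst integral_prod_continuous) auto
  moreover have "(d - c) * (F s t0)\<^sup>2 \<le> 4 * integral {c..d} (\<lambda>t. (F s t)\<^sup>2)" for s
    using linear_endpoint_bound[OF le(2), of t0 "k 0 0 + k 1 0 * s" "k 0 1 + k 1 1 * s"] p(2)
    by (simp add: F_def l u t0_def algebra_simps)
  then have "integral {a..b} (\<lambda>s. (d - c) * (F s t0)\<^sup>2) \<le>
      integral {a..b} (\<lambda>s. 4 * integral {c..d} (\<lambda>t. (F s t)\<^sup>2))"
  proof (intro integral_le)
    show "(\<lambda>s. (d - c) * (F s t0)\<^sup>2) integrable_on {a..b}"
      unfolding F_def by (intro integrable_continuous_real continuous_intros)
    have "continuous_on {a..b} (\<lambda>s. integral (cbox c d) (\<lambda>t. (F s t)\<^sup>2))"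
      unfolding F_def
      by (intro integral_continuous_on_param) (auto simp: split_beta intro!: continuous_intros)
    then show "(\<lambda>s. 4 * integral {c..d} (\<lambda>t. (F s t)\<^sup>2)) integrable_on {a..b}"
      by (intro integrable_continuous_real continuous_intros) simp
  qed
  moreover have "(b - a) * (F s0 t0)\<^sup>2 \<le> 4 * integral {a..b} (\<lambda>s. (F s t0)\<^sup>2)"
    using linear_endpoint_bound[OF le(1), of s0 "k 0 0 + k 0 1 * t0" "k 1 0 + k 1 1 * t0"] p(1)
    by (simp add: F_def l u s0_def algebra_simps)
  then have "(d - c) * ((b - a) * (F s0 t0)\<^sup>2) \<le> (d - c) * (4 * integral {a..b} (\<lambda>s. (F s t0)\<^sup>2))"
    using le by (intro mult_left_mono) auto
  moreover have "integral (cbox l u) (\<lambda>x. (f x)\<^sup>2) = integral (cbox l u) (\<lambda>x. (F (fst x) (snd x))\<^sup>2)"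
    by (intro integral_cong) (simp add: fF)
  moreover have "f p = F s0 t0" using fF[OF pm] by (simp add: s0_def t0_def)
  ultimately show ?thesis by (simp add: l u mult_ac)
qed

lemma mem_rect:
  "x \<in> rect p r \<longleftrightarrow> min (fst p) (fst r) \<le> fst x \<and> fst x \<le> max (fst p) (fst r) \<and>
     min (snd p) (snd r) \<le> snd x \<and> snd x \<le> max (snd p) (snd r)"
  by (auto simp: rect_def mem_box Basis_prod_def inner_prod_def)

lemma mem_cbox_plane:
  fixes x :: "real \<times> real"
  shows "x \<in> cbox l u \<longleftrightarrow> fst l \<le> fst x \<and> fst x \<le> fst u \<and> snd l \<le> snd x \<and> snd x \<le> snd u"
  by (auto simp: mem_box Basis_prod_def inner_prod_def)

lemma thin_cell_x_at_corner: "thin_cell_x z m w = rect m (fst w, snd z)"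
  by (simp add: thin_cell_x_def rect_def min.commute max.commute)

lemma thin_cell_y_at_corner: "thin_cell_y z m w = rect m (fst z, snd w)"
  by (simp add: thin_cell_y_def rect_def min.commute max.commute)

lemma small_cell_at_corner: "small_cell z m = rect m z"
  by (simp add: small_cell_def rect_def min.commute max.commute)

lemma extent_cbox_plane:
  assumes "fst l \<le> fst u" "snd l \<le> snd u"
  shows "extent (1, 0) (cbox l u) = fst u - fst l" "extent (0, 1) (cbox l u) = snd u - snd l"
  using assms by (simp_all add: extent_def interval_bounds_plane inner_prod_def)

section \<open>Elements at the inner corner of a small cell\<close>

text \<open>All four coarse cells have a corner at the crossing \<open>m\<close> of the division lines. Written as \<open>rect m r\<close>,
  they can be treated alike, whatever their orientation.\<close>

lemma corner_of_subcell:
  assumes "cbox l u \<subseteq> rect p r" "p \<in> cbox l u"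
  shows "fst p \<le> fst r \<Longrightarrow> fst p = fst l" "fst r \<le> fst p \<Longrightarrow> fst p = fst u"
    "snd p \<le> snd r \<Longrightarrow> snd p = snd l" "snd r \<le> snd p \<Longrightarrow> snd p = snd u"
proof -
  have "fst l \<le> fst u" "snd l \<le> snd u" using assms(2) by (auto simp: mem_cbox_plane)
  then have "l \<in> rect p r" "u \<in> rect p r" using assms(1) by (auto simp: mem_cbox_plane)
  then show "fst p \<le> fst r \<Longrightarrow> fst p = fst l" "fst r \<le> fst p \<Longrightarrow> fst p = fst u"
    "snd p \<le> snd r \<Longrightarrow> snd p = snd l" "snd r \<le> snd p \<Longrightarrow> snd p = snd u"
    using assms(2) by (auto simp: mem_cbox_plane mem_rect)
qed

lemma Q1_corner_bound_element:
  assumes P: "rect_division P \<omega>" "K \<in> P" and K: "K \<subseteq> rect p r" "p \<in> K"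
    and f: "f \<in> Q_space 1 K" and A: "A \<le> 4 * (extent (1, 0) K * extent (0, 1) K)"
  shows "A * (f p)\<^sup>2 \<le> 64 * integral K (\<lambda>x. (f x)\<^sup>2)"
proof -
  obtain l u where lu: "K = cbox l u" "fst l < fst u" "snd l < snd u"
    using rect_division_cell[OF P] .
  have "fst p = fst l \<or> fst p = fst u" "snd p = snd l \<or> snd p = snd u"
    using corner_of_subcell[of l u p r] K unfolding lu(1) by linarith+
  then have "(fst u - fst l) * (snd u - snd l) * (f p)\<^sup>2 \<le> 16 * integral K (\<lambda>x. (f x)\<^sup>2)"
    using Q1_corner_bound[of l u p f] lu f by auto
  moreover have "A * (f p)\<^sup>2 \<le> 4 * ((fst u - fst l) * (snd u - snd l)) * (f p)\<^sup>2"
    using A extent_cbox_plane[of l u] lu by (intro mult_right_mono) auto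
  ultimately show ?thesis by linarith
qed

text \<open>For \<open>x\<close> and \<open>y\<close> the endpoints of a short edge of the thin cell \<open>T\<close>: the lengthwise bisection of \<open>T\<close>
  is the only division that can cut this edge, and it does so in the middle. Hence the element at
  \<open>x\<close> contains at least half of the edge.\<close>

lemma thin_element_at:
  assumes T: "thin_cell_divided \<tau> P e f T" "convex T"
    and xy: "x \<in> T" "y \<in> T" "x \<bullet> e = y \<bullet> e" "(x \<bullet> f + y \<bullet> f) / 2 = mid f T"
  shows "\<exists>K\<in>P. K \<subseteq> T \<and> x \<in> K \<and> long_thin \<tau> e K \<and> (y \<in> K \<or> midpoint x y \<in> K)"
proof -
  obtain t where t: "{K\<in>P. K \<subseteq> T} = split_at e t T \<or>
         {K\<in>P. K \<subseteq> T} = (\<Union>L\<in>split_at e t T. split_at f (mid f T) L)"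
    using T(1) unfolding thin_cell_divided_def by (elim conjE exE) (rule that)
  have thin: "long_thin \<tau> e K" if "K \<in> P" "K \<subseteq> T" for K
    using T(1) that unfolding thin_cell_divided_def by simp
  define c where "c = midpoint x y"
  have c: "c \<in> T"
    using closed_segment_subset[OF xy(1,2) T(2)] midpoint_in_closed_segment[of x y]
    unfolding c_def by (rule subsetD)
  have ce: "c \<bullet> e = x \<bullet> e" "c \<bullet> f = mid f T"
    using xy(3,4) by (simp_all add: c_def midpoint_def inner_add_left)
  obtain H where H: "H \<in> split_at e t T" "x \<in> H" "y \<in> H" "c \<in> H"
  proof (cases "x \<bullet> e \<le> t")
    case True
    then show thesis
      using that[of "T \<inter> {x. x \<bullet> e \<le> t}"] xy(1-3) c ce(1) by (auto simp: split_at_def)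
  next
    case False
    then show thesis
      using that[of "T \<inter> {x. t \<le> x \<bullet> e}"] xy(1-3) c ce(1) by (auto simp: split_at_def)
  qed
  have "\<exists>K\<in>{K\<in>P. K \<subseteq> T}. x \<in> K \<and> (y \<in> K \<or> c \<in> K)"
    using t
  proof
    assume "{K\<in>P. K \<subseteq> T} = split_at e t T"
    then show ?thesis using H by blast
  next
    assume eq: "{K\<in>P. K \<subseteq> T} = (\<Union>L\<in>split_at e t T. split_at f (mid f T) L)"
    obtain K where "K \<in> split_at f (mid f T) H" "x \<in> K" "c \<in> K"
    proof (cases "x \<bullet> f \<le> mid f T")
      case True
      then show thesis
        using that[of "H \<inter> {x. x \<bullet> f \<le> mid f T}"] H ce(2) by (auto simp: split_at_def)
    next
      case False
      then show thesis
        using that[of "H \<inter> {x. mid f T \<le> x \<bullet> f}"] H ce(2) by (auto simp: split_at_def)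
    qed
    then show ?thesis unfolding eq using H(1) by blast
  qed
  then show ?thesis using thin unfolding c_def by blast
qed

text \<open>Conformity excludes hanging nodes. If \<open>K1\<close> shares a piece of the segment from \<open>m\<close> to
  \<open>m + s *\<^sub>R d\<close> in \<open>K2\<close>, it contains the whole segment: otherwise the end of the shared piece
  would lie in the open segment, and a face of \<open>K2\<close> with a point of an open segment contains the
  endpoints.\<close>

lemma conforming_neighbour_contains:
  fixes m d :: "real \<times> real"
  assumes face: "(K1 \<inter> K2) face_of K2" and convex: "convex K1" "convex K2"
    and K1: "m \<in> K1" "m + \<kappa> *\<^sub>R d \<in> K1" "\<kappa> > 0"
    and K2: "m \<in> K2" "m + s *\<^sub>R d \<in> K2" "s > 0" and "d \<noteq> 0"
  shows "m + s *\<^sub>R d \<in> K1"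
proof (cases "s \<le> \<kappa>")
  case True
  have "(1 - s / \<kappa>) *\<^sub>R m + (s / \<kappa>) *\<^sub>R (m + \<kappa> *\<^sub>R d) \<in> K1"
    using convex(1) K1 K2(3) True by (intro convexD) auto
  moreover have "(1 - s / \<kappa>) *\<^sub>R m + (s / \<kappa>) *\<^sub>R (m + \<kappa> *\<^sub>R d) = m + s *\<^sub>R d"
    using K1(3) by (simp add: algebra_simps)
  ultimately show ?thesis by simp
next
  case False
  let ?k = "m + \<kappa> *\<^sub>R d" and ?n = "m + s *\<^sub>R d"
  have "?k = (1 - \<kappa> / s) *\<^sub>R m + (\<kappa> / s) *\<^sub>R ?n" using K2(3) by (simp add: algebra_simps)
  moreover have "0 < \<kappa> / s" "\<kappa> / s < 1" using K1(3) K2(3) False by auto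
  moreover have "m \<noteq> ?n" using K2(3) \<open>d \<noteq> 0\<close> by simp
  ultimately have seg: "?k \<in> open_segment m ?n" unfolding in_segment by blast
  then have "?k \<in> K2" using closed_segment_subset[OF K2(1,2) convex(2)] segment_open_subset_closed by fastforce
  then show ?thesis using face seg K1(2) K2(1,2) unfolding face_of_def by blast
qed

lemma abs_diff_le_extent:
  assumes "rect_division P \<omega>" "K \<in> P" "x \<in> K" "y \<in> K"
  shows "\<bar>fst x - fst y\<bar> \<le> extent (1, 0) K" "\<bar>snd x - snd y\<bar> \<le> extent (0, 1) K"
  using rect_division_cell[OF assms(1,2)] assms(3,4)
  by (smt (verit) extent_cbox_plane mem_cbox_plane)+

text \<open>The value of the continuous function \<open>q\<close> at \<open>m\<close> is compared with \<open>c\<close> in the element \<open>K\<close> of the small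
  cell, and with \<open>c'\<close> in a thin element, both having a corner at \<open>m\<close>. By \<open>Q1_corner_bound\<close> this needs
  that both elements have at least a quarter of the area of the small cell. For \<open>K\<close> this follows from
  conformity with the two adjacent thin elements. The thin element across an edge of length \<open>b\<close> is at
  least \<open>b / 2\<close> thick and longer than thick, so its area is at least \<open>b\<^sup>2 / 4\<close>, which suffices if \<open>b\<close>
  is the longer side of the small cell. Due to this choice the constant is independent of the aspect
  ratios.\<close>

lemma small_cell_mean_jump:
  assumes P: "conforming_partition P \<omega>"
    and coarse: "coarse_corner_patch \<sigma> \<tau> z m w" and \<tau>: "\<tau> \<ge> 1"
    and divx: "thin_cell_divided \<tau> P (1, 0) (0, 1) (thin_cell_x z m w)"
    and divy: "thin_cell_divided \<tau> P (0, 1) (1, 0) (thin_cell_y z m w)"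
    and K: "K \<in> P" "K \<subseteq> small_cell z m" "m \<in> K"
    and sub: "small_cell z m \<subseteq> D" "thin_cell_x z m w \<subseteq> E" "thin_cell_y z m w \<subseteq> E"
    and q: "\<And>K. K \<in> P \<Longrightarrow> q \<in> Q_space 1 K"
    and int: "(\<lambda>x. (q x - c)\<^sup>2) integrable_on D" "(\<lambda>x. (q x - c')\<^sup>2) integrable_on E"
      "continuous_on \<omega> q"
  shows "\<bar>fst m - fst z\<bar> * \<bar>snd m - snd z\<bar> * (c - c')\<^sup>2 \<le>
    128 * (integral D (\<lambda>x. (q x - c)\<^sup>2) + integral E (\<lambda>x. (q x - c')\<^sup>2))"
proof -
  define a where "a = \<bar>fst m - fst z\<bar>"
  define b where "b = \<bar>snd m - snd z\<bar>"
  have R: "rect_division P \<omega>" using P unfolding conforming_partition_def rect_division_def by blast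
  have ne: "fst m \<noteq> fst z" "snd m \<noteq> snd z"
    using coarse unfolding coarse_corner_patch_def open_segment_def by auto
  have ab: "a > 0" "b > 0" using ne by (auto simp: a_def b_def)
  define dx :: "real \<times> real" where "dx = (fst z - fst m, 0)"
  define dy :: "real \<times> real" where "dy = (0, snd z - snd m)"
  have d0: "dx \<noteq> 0" "dy \<noteq> 0" using ne by (auto simp: dx_def dy_def zero_prod_def)
  have conv: "convex L" if "L \<in> P" for L
    using that by (auto elim!: rect_division_cell[OF R])
  have face: "(K \<inter> L) face_of L" if "L \<in> P" for L
    using P K(1) that unfolding conforming_partition_def by (metis inf_commute)
  obtain l u where lu: "K = cbox l u" "fst l < fst u" "snd l < snd u"
    using rect_division_cell[OF R K(1)] .
  note corner = corner_of_subcell[of l u m z, folded lu(1), OF K(2)[unfolded small_cell_at_corner] K(3)]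
  \<comment> \<open>the two edges of \<open>K\<close> at \<open>m\<close> run along the edges of the small cell\<close>
  have "fst z - fst m = (if fst m < fst z then a else - a)" by (simp add: a_def)
  then have "(fst u - fst l) / a * (fst z - fst m) = (if fst m < fst z then fst u - fst l else - (fst u - fst l))"
    using ab by simp
  then have kx: "m + ((fst u - fst l) / a) *\<^sub>R dx \<in> K"
    using corner(1,2) K(3) lu(2,3) unfolding lu(1) dx_def
    by (cases "fst m < fst z") (auto simp: mem_cbox_plane)
  have "snd z - snd m = (if snd m < snd z then b else - b)" by (simp add: b_def)
  then have "(snd u - snd l) / b * (snd z - snd m) = (if snd m < snd z then snd u - snd l else - (snd u - snd l))"
    using ab by simp
  then have ky: "m + ((snd u - snd l) / b) *\<^sub>R dy \<in> K"
    using corner(3,4) K(3) lu(2,3) unfolding lu(1) dy_def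
    by (cases "snd m < snd z") (auto simp: mem_cbox_plane)
  obtain X sx where X: "X \<in> P" "X \<subseteq> thin_cell_x z m w" "m \<in> X" "long_thin \<tau> (1, 0) X"
    and sx: "m + sx *\<^sub>R dy \<in> X" "sx = 1 \<or> sx = 1 / 2"
  proof -
    have "\<exists>L\<in>P. L \<subseteq> thin_cell_x z m w \<and> m \<in> L \<and> long_thin \<tau> (1, 0) L \<and>
        (m + dy \<in> L \<or> midpoint m (m + dy) \<in> L)"
      by (rule thin_element_at[OF divx])
         (auto simp: thin_cell_x_at_corner mem_cbox_plane dy_def rect_def inner_prod_def mid_def interval_bounds_plane)
    moreover have "midpoint m (m + dy) = m + (1 / 2) *\<^sub>R dy"
      by (simp add: midpoint_def algebra_simps flip: scaleR_add_left)
    ultimately show thesis using that[of _ 1] that[of _ "1 / 2"] by force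
  qed
  obtain Y sy where Y: "Y \<in> P" "Y \<subseteq> thin_cell_y z m w" "m \<in> Y" "long_thin \<tau> (0, 1) Y"
    and sy: "m + sy *\<^sub>R dx \<in> Y" "sy = 1 \<or> sy = 1 / 2"
  proof -
    have "\<exists>L\<in>P. L \<subseteq> thin_cell_y z m w \<and> m \<in> L \<and> long_thin \<tau> (0, 1) L \<and>
        (m + dx \<in> L \<or> midpoint m (m + dx) \<in> L)"
      by (rule thin_element_at[OF divy])
         (auto simp: thin_cell_y_at_corner mem_cbox_plane dx_def rect_def inner_prod_def mid_def interval_bounds_plane)
    moreover have "midpoint m (m + dx) = m + (1 / 2) *\<^sub>R dx"
      by (simp add: midpoint_def algebra_simps flip: scaleR_add_left)
    ultimately show thesis using that[of _ 1] that[of _ "1 / 2"] by force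
  qed
  have "m + sx *\<^sub>R dy \<in> K"
    by (rule conforming_neighbour_contains[OF face[OF X(1)] conv[OF K(1)] conv[OF X(1)] K(3) ky _ X(3) sx(1)])
       (use sx(2) lu ab d0 in auto)
  then have "b / 2 \<le> extent (0, 1) K"
    using abs_diff_le_extent(2)[OF R K(1) _ K(3)] sx(2) unfolding dy_def b_def by fastforce
  moreover have "m + sy *\<^sub>R dx \<in> K"
    by (rule conforming_neighbour_contains[OF face[OF Y(1)] conv[OF K(1)] conv[OF Y(1)] K(3) kx _ Y(3) sy(1)])
       (use sy(2) lu ab d0 in auto)
  then have "a / 2 \<le> extent (1, 0) K"
    using abs_diff_le_extent(1)[OF R K(1) _ K(3)] sy(2) unfolding dx_def a_def by fastforce
  ultimately have "a / 2 * (b / 2) \<le> extent (1, 0) K * extent (0, 1) K"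
    using ab by (intro mult_mono) auto
  then have areaK: "a * b \<le> 4 * (extent (1, 0) K * extent (0, 1) K)" by simp
  \<comment> \<open>of the two thin elements at \<open>m\<close>, the one across the longer edge of the small cell is large enough\<close>
  obtain Z r where Z: "Z \<in> P" "Z \<subseteq> rect m r" "m \<in> Z" "Z \<subseteq> E"
    and areaZ: "a * b \<le> 4 * (extent (1, 0) Z * extent (0, 1) Z)"
  proof (cases "a \<le> b")
    case True
    have "b / 2 \<le> extent (0, 1) X"
      using abs_diff_le_extent(2)[OF R X(1) sx(1) X(3)] sx(2) unfolding dy_def b_def by fastforce
    moreover have "\<tau> * extent (0, 1) X < extent (1, 0) X"
      using X(4) unfolding long_thin_def by (auto simp: Basis_prod_def)
    moreover have "1 * extent (0, 1) X \<le> \<tau> * extent (0, 1) X"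
      using \<tau> calculation(1) ab by (intro mult_right_mono) auto
    ultimately have "b / 2 \<le> extent (1, 0) X" "b / 2 \<le> extent (0, 1) X" by linarith+
    then have "b / 2 * (b / 2) \<le> extent (1, 0) X * extent (0, 1) X"
      using ab by (intro mult_mono) auto
    moreover have "a * b \<le> b * b" using True ab by (intro mult_right_mono) auto
    ultimately show thesis
      using that[of X "(fst w, snd z)"] X sub(2) by (auto simp: thin_cell_x_at_corner)
  next
    case False
    have "a / 2 \<le> extent (1, 0) Y"
      using abs_diff_le_extent(1)[OF R Y(1) sy(1) Y(3)] sy(2) unfolding dx_def a_def by fastforce
    moreover have "\<tau> * extent (1, 0) Y < extent (0, 1) Y"
      using Y(4) unfolding long_thin_def by (auto simp: Basis_prod_def)
    moreover have "1 * extent (1, 0) Y \<le> \<tau> * extent (1, 0) Y"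
      using \<tau> calculation(1) ab by (intro mult_right_mono) auto
    ultimately have "a / 2 \<le> extent (1, 0) Y" "a / 2 \<le> extent (0, 1) Y" by linarith+
    then have "a / 2 * (a / 2) \<le> extent (1, 0) Y * extent (0, 1) Y"
      using ab by (intro mult_mono) auto
    moreover have "a * b \<le> a * a" using False ab by (intro mult_left_mono) auto
    ultimately show thesis
      using that[of Y "(fst z, snd w)"] Y sub(3) by (auto simp: thin_cell_y_at_corner)
  qed
  have cell_le: "integral L (\<lambda>x. (q x - k)\<^sup>2) \<le> integral F (\<lambda>x. (q x - k)\<^sup>2)"
    if "L \<in> P" "L \<subseteq> F" "(\<lambda>x. (q x - k)\<^sup>2) integrable_on F" for L F k
  proof (rule integral_subset_le[OF that(2) _ that(3)])
    have "continuous_on L q"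
      using int(3) that(1) rect_divisionD(2)[OF R] continuous_on_subset by blast
    then have "continuous_on L (\<lambda>x. (q x - k)\<^sup>2)" by (intro continuous_intros)
    then show "(\<lambda>x. (q x - k)\<^sup>2) integrable_on L"
      using that(1) by (auto elim!: rect_division_cell[OF R] intro!: integrable_continuous)
  qed auto
  have "a * b * (q m - c)\<^sup>2 \<le> 64 * integral K (\<lambda>x. (q x - c)\<^sup>2)"
    using Q1_corner_bound_element[OF R K(1) _ K(3) Q1_minus_const[OF q[OF K(1)]] areaK] K(2)
    unfolding small_cell_at_corner by simp
  also have "\<dots> \<le> 64 * integral D (\<lambda>x. (q x - c)\<^sup>2)"
    using cell_le[OF K(1) _ int(1)] K(2) sub(1) by simp
  finally have 1: "a * b * (q m - c)\<^sup>2 \<le> 64 * integral D (\<lambda>x. (q x - c)\<^sup>2)" .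
  have "a * b * (q m - c')\<^sup>2 \<le> 64 * integral Z (\<lambda>x. (q x - c')\<^sup>2)"
    by (rule Q1_corner_bound_element[OF R Z(1-3) Q1_minus_const[OF q[OF Z(1)]] areaZ])
  also have "\<dots> \<le> 64 * integral E (\<lambda>x. (q x - c')\<^sup>2)"
    using cell_le[OF Z(1,4) int(2)] by simp
  finally have 2: "a * b * (q m - c')\<^sup>2 \<le> 64 * integral E (\<lambda>x. (q x - c')\<^sup>2)" .
  have "0 \<le> ((q m - c) + (q m - c'))\<^sup>2" by simp
  then have "(c - c')\<^sup>2 \<le> 2 * (q m - c)\<^sup>2 + 2 * (q m - c')\<^sup>2"
    by (simp add: power2_eq_square algebra_simps)
  then have "a * b * (c - c')\<^sup>2 \<le> a * b * (2 * (q m - c)\<^sup>2 + 2 * (q m - c')\<^sup>2)"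
    using ab by (intro mult_left_mono) auto
  then have "a * b * (c - c')\<^sup>2 \<le> 2 * (a * b * (q m - c)\<^sup>2) + 2 * (a * b * (q m - c')\<^sup>2)"
    by (simp add: algebra_simps)
  then show ?thesis using 1 2 unfolding a_def b_def by simp
qed

lemma coarse_patch_separated:
  assumes "coarse_corner_patch \<sigma> \<tau> z m w"
  shows "z \<in> small_cell z m" "m \<in> small_cell z m"
    "z \<notin> thin_cell_x z m w" "z \<notin> thin_cell_y z m w" "z \<notin> large_cell m w"
    "fst m \<noteq> fst z" "snd m \<noteq> snd z"
proof -
  have "fst m \<in> open_segment (fst z) (fst w)" "snd m \<in> open_segment (snd z) (snd w)"
    using assms unfolding coarse_corner_patch_def by auto
  then have "(fst z < fst m \<and> fst m < fst w) \<or> (fst w < fst m \<and> fst m < fst z)"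
    "(snd z < snd m \<and> snd m < snd w) \<or> (snd w < snd m \<and> snd m < snd z)"
    by (auto simp: open_segment_eq_real_ivl split: if_splits)
  then show "z \<in> small_cell z m" "m \<in> small_cell z m"
    "z \<notin> thin_cell_x z m w" "z \<notin> thin_cell_y z m w" "z \<notin> large_cell m w"
    "fst m \<noteq> fst z" "snd m \<noteq> snd z"
    by (auto simp: small_cell_def thin_cell_x_def thin_cell_y_def large_cell_def mem_rect)
qed

section \<open>Inf-sup stability of corner patches\<close>

text \<open>Two small cells in the same quadrant around \<open>z\<close> overlap.\<close>

lemma card_small_cells_le:
  assumes R: "rect_division \<C> D" and C: "\<And>m. m \<in> M \<Longrightarrow> small_cell z m \<in> \<C>"
    and M: "\<And>m. m \<in> M \<Longrightarrow> fst m \<noteq> fst z \<and> snd m \<noteq> snd z"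
  shows "card (small_cell z ` M) \<le> 4"
proof -
  define quadrant where "quadrant m = (fst z < fst m, snd z < snd m)" for m
  have same: "small_cell z m = small_cell z m'"
    if m: "m \<in> M" "m' \<in> M" "quadrant m = quadrant m'" for m m'
  proof (rule ccontr)
    assume ne: "small_cell z m \<noteq> small_cell z m'"
    define x where "x =
      (if fst z < fst m then (fst z + min (fst m) (fst m')) / 2 else (fst z + max (fst m) (fst m')) / 2,
       if snd z < snd m then (snd z + min (snd m) (snd m')) / 2 else (snd z + max (snd m) (snd m')) / 2)"
    have "x \<in> interior (small_cell z m)"
      unfolding small_cell_def rect_def interior_cbox x_def
      using m(3) M[OF m(1)] M[OF m(2)]
      by (auto simp: mem_box Basis_prod_def inner_prod_def quadrant_def min_def max_def)
    moreover have "x \<in> small_cell z m'"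
      unfolding small_cell_def mem_rect x_def
      using m(3) M[OF m(1)] M[OF m(2)] by (auto simp: quadrant_def min_def max_def)
    ultimately show False
      using interior_Int_other_cell[OF R C[OF m(1)] C[OF m(2)] ne] by blast
  qed
  have "small_cell z ` M \<subseteq> (\<lambda>t. small_cell z (inv_into M quadrant t)) ` UNIV"
  proof
    fix S assume "S \<in> small_cell z ` M"
    then obtain m where m: "m \<in> M" "S = small_cell z m" by blast
    have "quadrant (inv_into M quadrant (quadrant m)) = quadrant m" "inv_into M quadrant (quadrant m) \<in> M"
      using m(1) by (auto intro: f_inv_into_f inv_into_into)
    then have "S = small_cell z (inv_into M quadrant (quadrant m))" using same m by metis
    then show "S \<in> (\<lambda>t. small_cell z (inv_into M quadrant t)) ` UNIV" by blast
  qed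
  then have "card (small_cell z ` M) \<le> card (UNIV :: (bool \<times> bool) set)"
    by (rule surj_card_le[OF finite])
  then show ?thesis by simp
qed

lemma integral_one_small_cell:
  "integral (small_cell z m) (\<lambda>_. 1 :: real) = \<bar>fst m - fst z\<bar> * \<bar>snd m - snd z\<bar>"
proof -
  have "cbox (min (fst z) (fst m), min (snd z) (snd m)) (max (fst z) (fst m), max (snd z) (snd m)) \<noteq> {}"
    by (auto simp: box_ne_empty Basis_prod_def inner_prod_def)
  moreover have "max s t - min s t = \<bar>t - s\<bar>" for s t :: real by auto
  ultimately show ?thesis
    by (simp add: small_cell_def rect_def content_cbox' Basis_prod_def inner_prod_def mult.commute)
qed

lemma L2_norm_on_pos:
  assumes R: "rect_division P D" and q: "continuous_on D q" and x: "x \<in> D" "q x \<noteq> 0"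
  shows "L2_norm_on D q > 0"
proof -
  obtain K where K: "K \<in> P" "x \<in> K" using x(1) rect_divisionD(2)[OF R] by blast
  obtain l u where lu: "K = cbox l u" "fst l < fst u" "snd l < snd u"
    using rect_division_cell[OF R K(1)] .
  have sub: "K \<subseteq> D" using K(1) rect_divisionD(2)[OF R] by blast
  have cont: "continuous_on D (\<lambda>x. (q x)\<^sup>2)" using q by (intro continuous_intros)
  then have contK: "continuous_on (cbox l u) (\<lambda>x. (q x)\<^sup>2)"
    using sub continuous_on_subset unfolding lu(1) by blast
  have "box l u \<noteq> {}" using lu by (auto simp: box_ne_empty Basis_prod_def inner_prod_def)
  then have "integral (cbox l u) (\<lambda>x. (q x)\<^sup>2) \<noteq> 0"
    using integral_cbox_eq_0_iff[OF contK] K(2) x(2) lu(1) by auto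
  moreover have "integral (cbox l u) (\<lambda>x. (q x)\<^sup>2) \<ge> 0"
    by (intro integral_nonneg integrable_continuous contK) auto
  moreover have "integral (cbox l u) (\<lambda>x. (q x)\<^sup>2) \<le> integral D (\<lambda>x. (q x)\<^sup>2)"
    using sub unfolding lu(1)
    by (intro integral_subset_le integrable_continuous contK integrable_on_rect_division[OF R cont]) auto
  ultimately show ?thesis unfolding L2_norm_on_def by simp
qed

lemma L2_norm_on_le:
  assumes "integral D (\<lambda>x. (q x)\<^sup>2) \<le> k\<^sup>2 * integral E (\<lambda>x. (r x)\<^sup>2)" "0 \<le> k"
  shows "L2_norm_on D q \<le> k * L2_norm_on E r"
proof -
  have "L2_norm_on D q \<le> sqrt (k\<^sup>2 * integral E (\<lambda>x. (r x)\<^sup>2))"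
    unfolding L2_norm_on_def using assms(1) by (rule real_sqrt_le_mono)
  also have "\<dots> = k * L2_norm_on E r"
    unfolding L2_norm_on_def real_sqrt_mult using assms(2) by simp
  finally show ?thesis .
qed

text \<open>The denominator is \<open>2 \<cdot> 50\<close>: the factor \<open>2\<close> comes from \<open>inf_sup_from_subdomain\<close>, and
  \<open>50\<^sup>2 \<ge> 2 \<cdot> 1026\<close>, where \<open>1026\<close> bounds the square of the norm of \<open>q\<close> by the two squared
  oscillations and \<open>2\<close> accounts for choosing the larger of them.\<close>

lemma corner_patch_stability:
  assumes \<tau>: "\<tau> \<ge> 1" and patch: "corner_patch \<sigma> \<tau> z G P \<omega>"
    and divided: "thin_cells_divided \<tau> z G P"
    and stable: "inf_sup_stable P (omega_c z G) b" "inf_sup_stable P (omega_E z G) b" "b > 0"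
  shows "ereal (b / 100) \<le> inf_sup P \<omega>"
proof -
  define \<C> where "\<C> = coarse_cells z G"
  define S where "S = small_cell z ` fst ` G"
  define D where "D = omega_c z G"
  define E where "E = omega_E z G"
  have G: "G \<noteq> {}" and coarse: "\<And>m w. (m, w) \<in> G \<Longrightarrow> coarse_corner_patch \<sigma> \<tau> z m w"
    and \<omega>: "\<omega> = D \<union> E" and confC: "conforming_partition \<C> \<omega>" and conf: "conforming_partition P \<omega>"
    and refine: "\<forall>K\<in>P. \<exists>L\<in>\<C>. K \<subseteq> L"
    using patch unfolding corner_patch_def \<C>_def D_def E_def by blast+
  have RC: "rect_division \<C> \<omega>" and R: "rect_division P \<omega>"
    using confC conf unfolding conforming_partition_def rect_division_def by blast+
  have SC: "S \<subseteq> \<C>" and SD: "\<Union>S = D"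
    unfolding S_def \<C>_def D_def coarse_cells_def omega_c_def by force+
  have zS: "z \<in> L" if "L \<in> S" for L
    using that coarse_patch_separated(1)[OF coarse] unfolding S_def by force
  have zE: "L \<subseteq> E" if "L \<in> \<C>" "L \<notin> S" for L
  proof -
    obtain m w where mw: "(m, w) \<in> G"
      and L: "L \<in> {small_cell z m, thin_cell_x z m w, thin_cell_y z m w, large_cell m w}"
      using \<open>L \<in> \<C>\<close> unfolding \<C>_def coarse_cells_def by blast
    have "small_cell z m \<in> S" unfolding S_def using imageI[OF imageI[OF mw, of fst], of "small_cell z"] by simp
    then have "L \<in> {thin_cell_x z m w, thin_cell_y z m w, large_cell m w}" using L \<open>L \<notin> S\<close> by blast
    then show ?thesis using mw unfolding E_def omega_E_def by blast
  qed
  have E': "\<exists>L\<in>\<C> - S. x \<in> L" if "x \<in> E" for x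
  proof -
    obtain m w L where L: "(m, w) \<in> G" "L \<in> {thin_cell_x z m w, thin_cell_y z m w, large_cell m w}" "x \<in> L"
      using \<open>x \<in> E\<close> unfolding E_def omega_E_def by blast
    then have "L \<in> \<C>" unfolding \<C>_def coarse_cells_def by blast
    moreover have "z \<notin> L" using L(2) coarse_patch_separated(3-5)[OF coarse[OF L(1)]] by blast
    ultimately show ?thesis using zS L(3) by blast
  qed
  then have SE: "\<Union>(\<C> - S) = E" using zE by blast
  have UD: "\<Union>{K \<in> P. K \<subseteq> D} = D" using Union_refining_cells[OF RC R refine SC] unfolding SD .
  have UE: "\<Union>{K \<in> P. K \<subseteq> E} = E"
    using Union_refining_cells[OF RC R refine Diff_subset, of S] unfolding SE .
  have RD: "rect_division {K \<in> P. K \<subseteq> D} D" and RE: "rect_division {K \<in> P. K \<subseteq> E} E"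
    using rect_division_restrict[OF R UD] rect_division_restrict[OF R UE] .
  obtain m0 w0 where mw0: "(m0, w0) \<in> G" using G by (metis ex_in_conv surj_pair)
  have neD: "D \<noteq> {}"
    using mw0 coarse_patch_separated(1)[OF coarse[OF mw0]] unfolding D_def omega_c_def by blast
  have "m0 \<in> thin_cell_x z m0 w0" by (simp add: thin_cell_x_at_corner mem_rect)
  then have neE: "E \<noteq> {}" using mw0 unfolding E_def omega_E_def by blast
  have neg: "negligible (D \<inter> E)"
  proof (rule negligible_subset[OF negligible_cell_frontiers[OF RC]], rule subsetI)
    fix x assume x: "x \<in> D \<inter> E"
    then obtain L where L: "L \<in> S" "x \<in> L" using SD by blast
    obtain L' where L': "L' \<in> \<C> - S" "x \<in> L'" using x E' by blast
    have "x \<notin> interior L"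
      using interior_Int_other_cell[OF RC, of L L'] L L' SC by blast
    then have "x \<in> frontier L" using L(2) closure_subset[of L] by (auto simp: frontier_def)
    then show "x \<in> (\<Union>L\<in>\<C>. frontier L)" using L(1) SC by blast
  qed
  have cardS: "card S \<le> 4"
    unfolding S_def
  proof (rule card_small_cells_le[OF RC])
    fix m assume m: "m \<in> fst ` G"
    then show "small_cell z m \<in> \<C>" using SC unfolding S_def by blast
    obtain w where "(m, w) \<in> G" using m by auto
    then show "fst m \<noteq> fst z \<and> snd m \<noteq> snd z"
      using coarse_patch_separated(6,7)[OF coarse] by blast
  qed
  \<comment> \<open>The oscillations of \<open>q\<close> on \<open>D\<close> and \<open>E\<close> control \<open>q\<close>; the larger one provides the velocity.\<close>
  show ?thesis
    unfolding inf_sup_def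
  proof (rule INF_greatest)
    fix q assume "q \<in> {q \<in> M_space P \<omega>. \<exists>x\<in>\<omega>. q x \<noteq> 0}"
    then have q: "q \<in> M_space P \<omega>" and nz: "\<exists>x\<in>\<omega>. q x \<noteq> 0" by auto
    have cont: "continuous_on \<omega> q" and mean0: "integral \<omega> q = 0"
      using q unfolding M_space_def by auto
    have Q1: "q \<in> Q_space 1 K" if "K \<in> P" for K
      using q that rect_divisionD(2)[OF R] unfolding M_space_def by blast
    have contD: "continuous_on D q" and contE: "continuous_on E q"
      using cont continuous_on_subset unfolding \<omega> by blast+
    have posq: "L2_norm_on \<omega> q > 0" using L2_norm_on_pos[OF R cont] nz by blast
    define c where "c = average D q"
    define e where "e = average E q"
    define I where "I = integral D (\<lambda>x. (q x - c)\<^sup>2)"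
    define J where "J = integral E (\<lambda>x. (q x - e)\<^sup>2)"
    have intD: "(\<lambda>x. (q x - k)\<^sup>2) integrable_on D" for k
      by (rule integrable_on_rect_division[OF RD]) (intro continuous_intros contD)
    have intE: "(\<lambda>x. (q x - k)\<^sup>2) integrable_on E" for k
      by (rule integrable_on_rect_division[OF RE]) (intro continuous_intros contE)
    have "I \<ge> 0" "J \<ge> 0"
      unfolding I_def J_def using intD intE by (auto intro!: integral_nonneg)
    have jump_cell: "integral L (\<lambda>_. 1) * (c - e)\<^sup>2 \<le> 128 * (I + J)" if "L \<in> S" for L
    proof -
      obtain m w where mw: "(m, w) \<in> G" "L = small_cell z m" using \<open>L \<in> S\<close> unfolding S_def by auto
      have "\<Union>{K \<in> P. K \<subseteq> L} = L"
        using Union_refining_cells[OF RC R refine, of "{L}"] that SC by auto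
      then obtain K where K: "K \<in> P" "K \<subseteq> small_cell z m" "m \<in> K"
        using coarse_patch_separated(2)[OF coarse[OF mw(1)]] unfolding mw(2) by blast
      have "thin_cell_divided \<tau> P (1, 0) (0, 1) (thin_cell_x z m w)"
        "thin_cell_divided \<tau> P (0, 1) (1, 0) (thin_cell_y z m w)"
        using divided mw(1) unfolding thin_cells_divided_def by blast+
      moreover have "small_cell z m \<subseteq> D" "thin_cell_x z m w \<subseteq> E" "thin_cell_y z m w \<subseteq> E"
        using mw(1) unfolding D_def E_def omega_c_def omega_E_def by blast+
      ultimately show ?thesis
        unfolding mw(2) integral_one_small_cell I_def J_def
        using small_cell_mean_jump[OF conf coarse[OF mw(1)] \<tau> _ _ K _ _ _ Q1 intD intE cont] by blast
    qed
    have RS: "rect_division S D"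
      using rect_division_restrict[OF RC, of D] division_of_subset[of \<C> S] RC SC SD
        rect_divisionD(2)[OF RC] unfolding rect_division_def by auto
    have "integral D (\<lambda>_. 1 :: real) = (\<Sum>L\<in>S. integral L (\<lambda>_. 1))"
      by (intro integral_combine_division_topdown integrable_on_rect_division[OF RS] rect_divisionD(3)[OF RS]) simp
    then have "integral D (\<lambda>_. 1) * (c - e)\<^sup>2 = (\<Sum>L\<in>S. integral L (\<lambda>_. 1) * (c - e)\<^sup>2)"
      by (simp add: sum_distrib_right)
    also have "\<dots> \<le> real (card S) * (128 * (I + J))"
      using sum_bounded_above[OF jump_cell] by simp
    also have "\<dots> \<le> 4 * (128 * (I + J))"
      using cardS \<open>I \<ge> 0\<close> \<open>J \<ge> 0\<close> by (intro mult_right_mono) auto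
    finally have jump: "integral D (\<lambda>_. 1) * (c - e)\<^sup>2 \<le> 512 * (I + J)" by simp
    have "integral D (\<lambda>x. (q x - e)\<^sup>2) \<le> integral D (\<lambda>x. 2 * (q x - c)\<^sup>2 + 2 * (c - e)\<^sup>2)"
    proof (rule integral_le[OF intD])
      show "(\<lambda>x. 2 * (q x - c)\<^sup>2 + 2 * (c - e)\<^sup>2) integrable_on D"
        by (rule integrable_on_rect_division[OF RD]) (intro continuous_intros contD)
      show "(q x - e)\<^sup>2 \<le> 2 * (q x - c)\<^sup>2 + 2 * (c - e)\<^sup>2" for x
        using sum_squares_bound[of "q x - c" "c - e"] by (simp add: power2_eq_square algebra_simps)
    qed
    also have "\<dots> = 2 * I + integral D (\<lambda>_. 2 * (c - e)\<^sup>2)"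
      unfolding I_def using intD integrable_on_rect_division[OF RD, of "\<lambda>_. 2 * (c - e)\<^sup>2"]
      by (subst integral_add) auto
    also have "integral D (\<lambda>_. 2 * (c - e)\<^sup>2) = 2 * (integral D (\<lambda>_. 1) * (c - e)\<^sup>2)"
      using integral_mult_right[of D "2 * (c - e)\<^sup>2" "\<lambda>_. 1 :: real"] by simp
    finally have onD: "integral D (\<lambda>x. (q x - e)\<^sup>2) \<le> 2 * I + 1024 * (I + J)" using jump by linarith
    \<comment> \<open>\<open>q\<close> has mean zero, which makes \<open>0\<close> the best constant approximation\<close>
    have "integral \<omega> (\<lambda>x. (q x)\<^sup>2) \<le> integral \<omega> (\<lambda>x. (q x - e)\<^sup>2)"
    proof -
      have i: "(\<lambda>x. (q x)\<^sup>2) integrable_on \<omega>" "(\<lambda>x. 2 * e * q x) integrable_on \<omega>"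
        "(\<lambda>x. (q x - e)\<^sup>2) integrable_on \<omega>"
        by (intro integrable_on_rect_division[OF R] continuous_intros cont)+
      have "integral \<omega> (\<lambda>x. (q x)\<^sup>2 - 2 * e * q x) \<le> integral \<omega> (\<lambda>x. (q x - e)\<^sup>2)"
        using i by (intro integral_le integrable_diff) (auto simp: power2_eq_square algebra_simps)
      then show ?thesis using i(1,2) mean0 by (simp add: integral_diff)
    qed
    also have "\<dots> = integral D (\<lambda>x. (q x - e)\<^sup>2) + J"
      unfolding \<omega> J_def by (rule integral_Un[OF intD intE neg])
    finally have "integral \<omega> (\<lambda>x. (q x)\<^sup>2) \<le> integral D (\<lambda>x. (q x - e)\<^sup>2) + J" .
    also have "\<dots> \<le> (2 * I + 1024 * (I + J)) + J" using onD by (rule add_right_mono)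
    also have "\<dots> \<le> 1026 * (I + J)" using \<open>J \<ge> 0\<close> by (simp add: algebra_simps)
    finally have total: "integral \<omega> (\<lambda>x. (q x)\<^sup>2) \<le> 1026 * (I + J)" .
    have fin: "ereal (b / 100) \<le> (SUP v \<in> {v \<in> V_space P \<omega>. \<exists>x\<in>\<omega>. v x \<noteq> 0}.
        ereal (integral \<omega> (\<lambda>x. q x * divergence v x) / (H1_seminorm_on \<omega> v * L2_norm_on \<omega> q)))"
      if F: "\<Union>{K \<in> P. K \<subseteq> F} = F" "F \<noteq> {}" "inf_sup_stable P F b"
        and le: "integral \<omega> (\<lambda>x. (q x)\<^sup>2) \<le> 2500 * integral F (\<lambda>x. (q x - average F q)\<^sup>2)" for F
    proof -
      have dom: "1 / 50 * L2_norm_on \<omega> q \<le> L2_norm_on F (\<lambda>x. q x - average F q)"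
        using L2_norm_on_le[of \<omega> q 50 F "\<lambda>x. q x - average F q"] le by simp
      have "\<exists>x\<in>F. q x - average F q \<noteq> 0"
      proof (rule ccontr)
        assume "\<not> ?thesis"
        then have "integral F (\<lambda>x. (q x - average F q)\<^sup>2) = integral F (\<lambda>_. 0)"
          by (intro integral_cong) simp
        then have "L2_norm_on F (\<lambda>x. q x - average F q) = 0"
          unfolding L2_norm_on_def by simp
        then show False using dom posq by simp
      qed
      then show ?thesis
        using inf_sup_from_subdomain[OF R F stable(3) q _ posq dom] by simp
    qed
    show "ereal (b / 100) \<le> (SUP v \<in> {v \<in> V_space P \<omega>. \<exists>x\<in>\<omega>. v x \<noteq> 0}.
        ereal (integral \<omega> (\<lambda>x. q x * divergence v x) / (H1_seminorm_on \<omega> v * L2_norm_on \<omega> q)))"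
    proof (cases "J \<le> I")
      case True
      then have "1026 * (I + J) \<le> 2500 * I" using \<open>I \<ge> 0\<close> by simp
      then show ?thesis
        by (intro fin[OF UD neD stable(1)[folded D_def]] order_trans[OF total]) (simp add: I_def c_def)
    next
      case False
      then have "1026 * (I + J) \<le> 2500 * J" using \<open>J \<ge> 0\<close> by simp
      then show ?thesis
        by (intro fin[OF UE neE stable(2)[folded E_def]] order_trans[OF total]) (simp add: J_def e_def)
    qed
  qed
qed

lemma inf_sup_stable_mono:
  "inf_sup_stable P D b \<Longrightarrow> b' \<le> b \<Longrightarrow> inf_sup_stable P D b'"
  unfolding inf_sup_stable_def by (meson ereal_less_eq(3) order_trans)

theorem theorem3:
  fixes \<beta> \<beta>\<^sub>c :: real
  assumes "\<beta> > 0" and "\<beta>\<^sub>c > 0"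
  shows "\<exists>\<beta>\<^sub>P>0. \<forall>\<sigma> \<tau> z G P \<omega>.
           \<sigma> \<ge> 1 \<longrightarrow> \<tau> \<ge> 1 \<longrightarrow>
           corner_patch \<sigma> \<tau> z G P \<omega> \<longrightarrow>
           inf_sup_stable P (omega_c z G) \<beta>\<^sub>c \<longrightarrow>
           thin_cells_divided \<tau> z G P \<longrightarrow>
           inf_sup_stable P (omega_E z G) \<beta> \<longrightarrow>
           inf_sup P \<omega> \<ge> ereal \<beta>\<^sub>P"
proof (intro exI conjI allI impI)
  show "min \<beta> \<beta>\<^sub>c / 100 > 0" using assms by simp
  fix \<sigma> \<tau> z G P \<omega>
  assume "\<sigma> \<ge> 1" "\<tau> \<ge> 1" "corner_patch \<sigma> \<tau> z G P \<omega>" "inf_sup_stable P (omega_c z G) \<beta>\<^sub>c"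
    "thin_cells_divided \<tau> z G P" "inf_sup_stable P (omega_E z G) \<beta>"
  then show "inf_sup P \<omega> \<ge> ereal (min \<beta> \<beta>\<^sub>c / 100)"
    using assms by (intro corner_patch_stability[of \<tau> \<sigma> z G P \<omega> "min \<beta> \<beta>\<^sub>c"]) (auto elim: inf_sup_stable_mono)
qed

end
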